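(* Let $k\ge 2$ and $d\ge 1$ be integers, let $0<\theta<1$ be real with $d\theta>1$, and let $p\in(1,\infty)$ be determined by $d\theta=d^{1/p}$. Suppose that $(x_i)_{i=1}^\infty$ is a normalized block sequence in $T_k(d,\theta)$ and that there is a sequence $(v_i)_{i=1}^\infty\subset\omega^{\not\downarrow k}$ such that: (1) $v_1\le x_1<v_2\le x_2<v_3\le x_3<\cdots$; (2) $\mathrm{supp}(x_i)\subset X_{v_i}^{\max}$ and $v_{i+1}\in X_{v_i}^{\max}$ for every $i\ge1$. Then $(x_i)$ is equivalent to the canonical basis of $\ell_p$.
   Context: Sequences and orders. $\omega=\{0,1,2,\dots\}$. For an integer $k\ge1$, $\omega^{\not\downarrow\le k}$ is the set of all non-decreasing finite sequences of elements of $\omega$ of length at most $k$ (including the empty sequence $()$), and $\omega^{\not\downarrow k}$ is the set of those of length exactly $k$. Write $s\sqsubset t$ if $s$ is a proper initial segment of $t$. Let $<_{\mathrm{lex}}$ be the lexicographic order in which a proper initial segment precedes the longer sequence. The well-order $\prec$ (of order type $\omega$) on $\omega^{\not\downarrow\le k}$ is: $()\prec s$ for all nonempty $s$; and for nonempty sequences, $(s_1,\dots,s_i)\prec(t_1,\dots,t_j)$ iff $s_i<t_j$, or $s_i=t_j$ and $(s_1,\dots,s_i)<_{\mathrm{lex}}(t_1,\dots,t_j)$. The spaces $\mathcal E_k$. An $\mathcal E_k$-tree is a function $\widehat X:\omega^{\not\downarrow\le k}\to\omega^{\not\downarrow\le k}$ preserving $\prec$ and $\sqsubset$ (hence preserving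 lengths). $\mathcal E_k$ is the collection of all sets $X=\widehat X[\omega^{\not\downarrow k}]$, for $\widehat X$ an $\mathcal E_k$-tree. For $X\in\mathcal E_k$ and $n\ge1$, $r_n(X)$ is the set of the $\prec$-least $n$ elements of $X$, and $\mathcal{AR}^k=\{r_n(X):X\in\mathcal E_k,\ n\ge1\}$. The sets $X_v^{\max}$. For $v=(n_1,\dots,n_k)\in\omega^{\not\downarrow k}$ put $f_j(0)=n_j$ and $f_j(m)=n_k+m$ for $m\ge1$, $1\le j\le k$. The map $\widehat X_v(m_1,\dots,m_l)=(f_1(m_1),\dots,f_l(m_l))$ is an $\mathcal E_k$-tree, and $X_v^{\max}=\widehat X_v[\omega^{\not\downarrow k}]\in\mathcal E_k$. The Banach space $T_k(d,\theta)$. For nonempty finite $E,F\subset\omega^{\not\downarrow k}$, $E<F$ (resp. $E\le F$) means $\max_\prec E\prec\min_\prec F$ (resp. $\preceq$). Let $c_{00}(\omega^{\not\downarrow k})$ be the space of finitely supported functions $x:\omega^{\not\downarrow k}\to\mathbb R$, with canonical basis $(e_v)$, and $Ex=\sum_{v\in E}x_ve_v$. A sequence $(E_i)_{i=1}^m$ in $\mathcal{AR}^k$ is $d$-admissible if $m\le d$ and $E_1<\cdots<E_m$. Put $|x|_0=\max_v|x_v|$ and $|x|_{j+1}=\max\{|x|_j,\ \theta\max\{\sum_{i=1}^m|E_ix|_j:1\le m\le d,\ (E_i)_{i=1}^m\ d\text{-admissible}\}\}$, and $\|x\|=\sup_j|x|_j$. $T_k(d,\theta)$ is the completion of $c_{00}(\omega^{\not\downarrow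 k})$ in this norm, with basis $(e_v)$ ordered by $\prec$. For finitely supported $x,y$ and $v\in\omega^{\not\downarrow k}$, $x<y$, $x<v$, $v\le x$ etc. mean the corresponding relation for $\mathrm{supp}(x),\mathrm{supp}(y),\{v\}$. A block sequence is a sequence of nonzero finitely supported vectors with $x_1<x_2<\cdots$; normalized means all norms equal $1$. *)

theory Defs
  imports Complex_Main "HOL-Library.Sublist"
begin

definition nd :: "nat \<Rightarrow> nat list set" where
  "nd k = {s. sorted s \<and> length s = k}"

definition nd_le :: "nat \<Rightarrow> nat list set" where
  "nd_le k = {s. sorted s \<and> length s \<le> k}"

text \<open>In \<^const>\<open>lexord\<close> a proper initial segment precedes the longer list.\<close>

definition prec :: "nat list \<Rightarrow> nat list \<Rightarrow> bool" (infix "\<prec>" 50) where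
  "s \<prec> t \<longleftrightarrow>
     (s = [] \<and> t \<noteq> []) \<or>
     (s \<noteq> [] \<and> t \<noteq> [] \<and>
       (last s < last t \<or> (last s = last t \<and> (s, t) \<in> lexord {(a, b). a < b})))"

definition E_tree :: "nat \<Rightarrow> (nat list \<Rightarrow> nat list) \<Rightarrow> bool" where
  "E_tree k f \<longleftrightarrow>
     f ` nd_le k \<subseteq> nd_le k \<and>
     (\<forall>s\<in>nd_le k. \<forall>t\<in>nd_le k. s \<prec> t \<longrightarrow> f s \<prec> f t) \<and>
     (\<forall>s\<in>nd_le k. \<forall>t\<in>nd_le k. strict_prefix s t \<longrightarrow> strict_prefix (f s) (f t))"

definition E_space :: "nat \<Rightarrow> nat list set set" where
  "E_space k = {f ` nd k | f. E_tree k f}"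

text \<open>The \<open>n\<close> least elements of \<open>X\<close> are those with fewer than \<open>n\<close> predecessors in \<open>X\<close>; for
  \<open>X \<subseteq> nd k\<close> with \<open>k \<ge> 1\<close> every element has only finitely many predecessors, so
  \<^const>\<open>card\<close> is the true cardinality.\<close>

definition r :: "nat \<Rightarrow> nat list set \<Rightarrow> nat list set" where
  "r n X = {x \<in> X. card {y \<in> X. y \<prec> x} < n}"

definition AR :: "nat \<Rightarrow> nat list set set" where
  "AR k = {r n X | n X. n \<ge> 1 \<and> X \<in> E_space k}"

text \<open>For \<open>v = (n\<^sub>1, \<dots>, n\<^sub>k)\<close>, \<^const>\<open>map2\<close> truncates to the shorter list, so the value at
  \<open>(m\<^sub>1, \<dots>, m\<^sub>l)\<close> with \<open>l \<le> k\<close> is \<open>(f\<^sub>1 m\<^sub>1, \<dots>, f\<^sub>l m\<^sub>l)\<close>.\<close>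

definition X_max_tree :: "nat list \<Rightarrow> nat list \<Rightarrow> nat list" where
  "X_max_tree v ms = map2 (\<lambda>n m. if m = 0 then n else last v + m) v ms"

definition X_max :: "nat \<Rightarrow> nat list \<Rightarrow> nat list set" where
  "X_max k v = X_max_tree v ` nd k"

text \<open>For nonempty finite sets these say \<open>max E \<prec> min F\<close> and \<open>max E \<preceq> min F\<close>. They are only
  applied to nonempty finite sets.\<close>

definition set_less :: "nat list set \<Rightarrow> nat list set \<Rightarrow> bool" where
  "set_less E F \<longleftrightarrow> (\<forall>u\<in>E. \<forall>v\<in>F. u \<prec> v)"

definition set_le :: "nat list set \<Rightarrow> nat list set \<Rightarrow> bool" where
  "set_le E F \<longleftrightarrow> (\<forall>u\<in>E. \<forall>v\<in>F. u \<prec> v \<or> u = v)"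

definition supp :: "('a \<Rightarrow> real) \<Rightarrow> 'a set" where
  "supp x = {v. x v \<noteq> 0}"

text \<open>Vectors are functions on all lists that vanish off \<^term>\<open>nd k\<close>.\<close>

definition c00 :: "nat \<Rightarrow> (nat list \<Rightarrow> real) set" where
  "c00 k = {x. finite (supp x) \<and> supp x \<subseteq> nd k}"

definition restr :: "'a set \<Rightarrow> ('a \<Rightarrow> real) \<Rightarrow> 'a \<Rightarrow> real" where
  "restr E x = (\<lambda>v. if v \<in> E then x v else 0)"

text \<open>The sequence \<open>E\<^sub>1, \<dots>, E\<^sub>m\<close> is indexed from \<open>0\<close> as \<open>E 0, \<dots>, E (m - 1)\<close>.\<close>

definition admissible :: "nat \<Rightarrow> nat \<Rightarrow> nat \<Rightarrow> (nat \<Rightarrow> nat list set) \<Rightarrow> bool" where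
  "admissible k d m E \<longleftrightarrow>
     m \<le> d \<and> (\<forall>i<m. E i \<in> AR k) \<and> (\<forall>i. Suc i < m \<longrightarrow> set_less (E i) (E (Suc i)))"

text \<open>The sets under \<^const>\<open>Max\<close> are finite and nonempty for \<open>x\<close> in \<^term>\<open>c00 k\<close> and
  \<open>d \<ge> 1\<close>: only the traces of the \<open>E i\<close> on the support of \<open>x\<close> matter.\<close>

primrec T_level :: "nat \<Rightarrow> nat \<Rightarrow> real \<Rightarrow> nat \<Rightarrow> (nat list \<Rightarrow> real) \<Rightarrow> real" where
  "T_level k d \<theta> 0 x = Max {\<bar>x v\<bar> | v. v \<in> nd k}"
| "T_level k d \<theta> (Suc j) x =
     max (T_level k d \<theta> j x)
         (\<theta> * Max {\<Sum>i<m. T_level k d \<theta> j (restr (E i) x) | m E.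
                     1 \<le> m \<and> m \<le> d \<and> admissible k d m E})"

text \<open>The norm of \<open>T\<^sub>k(d, \<theta>)\<close> on its dense subspace \<^term>\<open>c00 k\<close>. Block sequences, and finite
  linear combinations of their terms, lie in this subspace, so the completion itself is not
  constructed.\<close>

definition T_norm :: "nat \<Rightarrow> nat \<Rightarrow> real \<Rightarrow> (nat list \<Rightarrow> real) \<Rightarrow> real" where
  "T_norm k d \<theta> x = (SUP j. T_level k d \<theta> j x)"

definition block_sequence :: "nat \<Rightarrow> (nat \<Rightarrow> nat list \<Rightarrow> real) \<Rightarrow> bool" where
  "block_sequence k x \<longleftrightarrow>
     (\<forall>i. x i \<in> c00 k \<and> supp (x i) \<noteq> {} \<and> set_less (supp (x i)) (supp (x (Suc i))))"

definition normalized_block_sequence ::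
    "nat \<Rightarrow> nat \<Rightarrow> real \<Rightarrow> (nat \<Rightarrow> nat list \<Rightarrow> real) \<Rightarrow> bool" where
  "normalized_block_sequence k d \<theta> x \<longleftrightarrow>
     block_sequence k x \<and> (\<forall>i. T_norm k d \<theta> (x i) = 1)"

definition lp_norm :: "real \<Rightarrow> (nat \<Rightarrow> real) \<Rightarrow> real" where
  "lp_norm p z = (\<Sum>j. \<bar>z j\<bar> powr p) powr (1 / p)"

definition lp_basis :: "nat \<Rightarrow> nat \<Rightarrow> real" where
  "lp_basis i = (\<lambda>j. if j = i then 1 else 0)"

text \<open>Equivalence of sequences \<open>x\<close> and \<open>y\<close> of vectors, in function spaces with norms \<open>N\<close> and
  \<open>M\<close>: two-sided estimates, uniform over all finite scalar sequences.\<close>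

definition equivalent_sequences ::
    "(('a \<Rightarrow> real) \<Rightarrow> real) \<Rightarrow> (nat \<Rightarrow> 'a \<Rightarrow> real) \<Rightarrow>
     (('b \<Rightarrow> real) \<Rightarrow> real) \<Rightarrow> (nat \<Rightarrow> 'b \<Rightarrow> real) \<Rightarrow> bool" where
  "equivalent_sequences N x M y \<longleftrightarrow>
     (\<exists>c C. 0 < c \<and> 0 < C \<and>
       (\<forall>n (a :: nat \<Rightarrow> real).
          c * M (\<lambda>t. \<Sum>i<n. a i * y i t) \<le> N (\<lambda>s. \<Sum>i<n. a i * x i s) \<and>
          N (\<lambda>s. \<Sum>i<n. a i * x i s) \<le> C * M (\<lambda>t. \<Sum>i<n. a i * y i t)))"

end

(*
  Admissible families made of initial parts of the sets X_max turn (x i) into a sequence whose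
  norm is superadditive, with factor \<theta>, over d successive sets of indices. The lower estimate
  follows by evaluating the d-adic tree in which the index i sits at a depth l i with
  d ^ (- l i) comparable to the i-th share of the l_p norm: by d * \<theta> = d powr (1 / p),
  the weight \<theta> ^ l i is the corresponding extremal l_q coefficient.

  For the upper estimate, let a norming functional be given by its tree of admissible sets and
  distribute a unit mass over the leaves, each node dividing its mass evenly among its children.
  The part of the functional seen by one x i consists of consecutive leaves, and its dual norm is
  at most (2 / \<theta>) * m powr (1 - 1 / p), where m is the mass of these leaves. As the masses
  belonging to different x i add up to at most 1, Hoelder's inequality finishes the proof.
*)

theory Submission
  imports Defs "HOL-Analysis.Convex"
begin

section \<open>The order and the sets \<open>X_max\<close>\<close>

text \<open>In the upper estimate the danger is a constant that grows with the depth of the tree.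
  Going from a child to its parent multiplies a functional by \<open>\<theta>\<close> and divides
  masses by at most \<open>d\<close>; by the choice of \<open>p\<close>, a bound proportional to
  mass to the power \<open>1 - 1 / p\<close> survives this as long as the part in question meets
  only one child. If the part contains all leaves of some child, its mass is at least
  \<open>1 / d\<close> and the trivial bound by the norm is enough; this is the origin of the factor
  \<open>1 / \<theta>\<close>. Otherwise a run of consecutive leaves meets at most two children, in
  a final part of the first and an initial part of the second. Such end pieces never split again
  without swallowing a whole child, so the factor \<open>2\<close> is paid only once. This is why
  final and initial parts have a bound of their own in the induction. In the lower estimate the
  constant is \<open>\<theta>\<^sup>2\<close>: one factor pays for rounding the shares to powers of
  \<open>1 / d\<close>, the other for one extra level of the tree, which separates the
  points.\<close>

lemma prec_irrefl: "\<not> s \<prec> s"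
  by (auto simp: prec_def lexord_irreflexive)

lemma prec_trans: "s \<prec> t \<Longrightarrow> t \<prec> u \<Longrightarrow> s \<prec> u"
  unfolding prec_def
  by (auto intro: lexord_trans[of s t _ u] simp: trans_def)

lemma prec_linear: "s \<prec> t \<or> s = t \<or> t \<prec> s"
  unfolding prec_def using lexord_linear[of "{(a::nat, b). a < b}" s t] by force

lemma sorted_nth_le_last:
  assumes "sorted (s :: nat list)" "i < length s"
  shows "s ! i \<le> last s"
proof -
  have "s \<noteq> []" using assms by auto
  then have "last s = s ! (length s - 1)" by (simp add: last_conv_nth)
  then show ?thesis using assms by (auto intro: sorted_nth_mono)
qed

text \<open>The order compares last entries first, and the last entry of a sorted list is its
  largest: every entry of \<open>y\<close> is at most \<open>last x\<close>, which leaves finitely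
  many lists of length \<open>k\<close>.\<close>

lemma finite_prec_below: "finite {y \<in> nd k. y \<prec> x}"
proof (rule finite_subset)
  show "{y \<in> nd k. y \<prec> x} \<subseteq> {xs. set xs \<subseteq> {..last x} \<and> length xs = k}"
  proof clarify
    fix y assume y: "y \<in> nd k" "y \<prec> x"
    have "set y \<subseteq> {..last x}"
    proof
      fix a assume "a \<in> set y"
      then have "a \<le> last y" and "y \<noteq> []"
        using y sorted_nth_le_last[of y] by (auto simp: in_set_conv_nth nd_def)
      then show "a \<in> {..last x}" using y by (auto simp: prec_def)
    qed
    then show "set y \<subseteq> {..last x} \<and> length y = k" using y by (simp add: nd_def)
  qed
qed (simp add: finite_lists_length_eq)

section \<open>The trees \<open>X_max_tree v\<close> and their nesting\<close>

lemma length_X_max_tree [simp]: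
  "v \<in> nd k \<Longrightarrow> ms \<in> nd_le k \<Longrightarrow> length (X_max_tree v ms) = length ms"
  by (simp add: X_max_tree_def nd_def nd_le_def)

lemma nth_X_max_tree:
  assumes "v \<in> nd k" "ms \<in> nd_le k" "i < length ms"
  shows "X_max_tree v ms ! i = (if ms ! i = 0 then v ! i else last v + ms ! i)"
  using assms by (simp add: X_max_tree_def nd_def nd_le_def)

lemma X_max_tree_in_nd_le:
  assumes v: "v \<in> nd k" and ms: "ms \<in> nd_le k"
  shows "X_max_tree v ms \<in> nd_le k"
proof -
  have "sorted (X_max_tree v ms)"
    unfolding sorted_iff_nth_mono_less
  proof (intro allI impI)
    fix i j assume ij: "i < j" "j < length (X_max_tree v ms)"
    then have j: "j < length ms" "i < length ms" using v ms by auto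
    have "ms ! i \<le> ms ! j" using ms ij j by (simp add: nd_le_def sorted_iff_nth_mono)
    moreover have "v ! i \<le> v ! j" "v ! i \<le> last v"
      using v ms ij j sorted_nth_le_last[of v i] by (auto simp: nd_def nd_le_def sorted_iff_nth_mono)
    ultimately show "X_max_tree v ms ! i \<le> X_max_tree v ms ! j"
      using v ms j by (auto simp: nth_X_max_tree)
  qed
  then show ?thesis using ms v by (simp add: nd_le_def[of k])
qed

lemma nd_subset_nd_le: "nd k \<subseteq> nd_le k"
  by (auto simp: nd_def nd_le_def)

lemma X_max_tree_in_nd:
  "v \<in> nd k \<Longrightarrow> ms \<in> nd k \<Longrightarrow> X_max_tree v ms \<in> nd k"
  using X_max_tree_in_nd_le[of v k ms] nd_subset_nd_le[of k] length_X_max_tree[of v k ms]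
  by (auto simp: nd_def nd_le_def)

lemma X_max_subset_nd: "v \<in> nd k \<Longrightarrow> X_max k v \<subseteq> nd k"
  by (auto simp: X_max_def X_max_tree_in_nd)

text \<open>Entry \<open>i\<close> of the image depends only on \<open>i\<close> and on entry
  \<open>i\<close> of the argument, so a common beginning is kept.\<close>

lemma X_max_tree_strict_prefix:
  assumes v: "v \<in> nd k" and s: "s \<in> nd_le k" and t: "t \<in> nd_le k" and st: "strict_prefix s t"
  shows "strict_prefix (X_max_tree v s) (X_max_tree v t)"
proof -
  obtain z zs where t_eq: "t = s @ z # zs" using st by (auto elim: strict_prefixE')
  have "prefix (X_max_tree v s) (X_max_tree v t)"
    unfolding prefix_def
  proof
    show "X_max_tree v t = X_max_tree v s @ drop (length s) (X_max_tree v t)"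
      using v s t t_eq by (intro nth_equalityI) (auto simp: nth_append nth_X_max_tree)
  qed
  moreover have "length (X_max_tree v s) \<noteq> length (X_max_tree v t)" using v s t t_eq by simp
  ultimately show ?thesis by (auto simp: strict_prefix_def)
qed

lemma last_X_max_tree:
  assumes "v \<in> nd k" "s \<in> nd_le k" "s \<noteq> []"
  shows "last (X_max_tree v s) = (if last s = 0 then v ! (length s - 1) else last v + last s)"
proof -
  have "X_max_tree v s \<noteq> []" using assms length_X_max_tree[of v k s] by fastforce
  then show ?thesis using assms by (simp add: last_conv_nth nth_X_max_tree)
qed

lemma strict_prefix_lexord: "strict_prefix s t \<Longrightarrow> (s, t) \<in> lexord R"
  by (auto elim!: strict_prefixE' intro: lexord_append_rightI)

text \<open>The delicate entries are zeros: they go to \<open>v ! i\<close>, which depends on the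
  position, while a positive \<open>m\<close> goes to \<open>last v + m\<close> at every position.
  Since \<open>v\<close> is sorted, \<open>v ! i\<close> is at most \<open>last v\<close>, so images
  of zeros stay below images of positive entries.\<close>

lemma X_max_tree_prec:
  assumes v: "v \<in> nd k" and s: "s \<in> nd_le k" and t: "t \<in> nd_le k" and st: "s \<prec> t"
  shows "X_max_tree v s \<prec> X_max_tree v t"
proof (cases "s = []")
  case True
  then have "t \<noteq> []" using st by (simp add: prec_def)
  then have "X_max_tree v t \<noteq> []" using t v length_X_max_tree[of v k t] by fastforce
  moreover have "X_max_tree v s = []" using True by (simp add: X_max_tree_def)
  ultimately show ?thesis by (simp add: prec_def)
next
  case False
  then have ne: "s \<noteq> []" "t \<noteq> []" using st by (auto simp: prec_def)
  then have ne': "X_max_tree v s \<noteq> []" "X_max_tree v t \<noteq> []"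
    using s t v length_X_max_tree[of v k t] length_X_max_tree[of v k s] by fastforce+
  note l = last_X_max_tree[OF v s ne(1)] last_X_max_tree[OF v t ne(2)]
  have vle: "v ! (length s - 1) \<le> last v"
    using v s ne by (intro sorted_nth_le_last) (auto simp: nd_def nd_le_def neq_Nil_conv)
  consider (less) "last s < last t"
    | (pre) "last s = last t" "strict_prefix s t"
    | (lex) i where "last s = last t" "i < length s" "i < length t" "take i s = take i t" "s ! i < t ! i"
  proof -
    have "strict_prefix s t" if "length s < length t" "take (length s) t = s"
      using that take_is_prefix[of "length s" t] by (auto simp: strict_prefix_def)
    then show thesis
      using that st ne by (auto simp: prec_def lexord_take_index_conv)
  qed
  then show ?thesis
  proof cases
    case less
    then show ?thesis using l ne' vle by (auto simp: prec_def)
  next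
    case pre
    \<comment> \<open>If the common last entry is \<open>0\<close>, its two images sit at different
      positions and may differ. The image of \<open>t\<close> then has the larger last entry, and
      the prefix relation decides only in case of a tie.\<close>
    have "length s \<le> length t" using pre(2) by (simp add: prefix_length_le strict_prefix_def)
    then have "v ! (length s - 1) \<le> v ! (length t - 1)"
      using v t ne by (auto intro!: sorted_nth_mono simp: nd_def nd_le_def neq_Nil_conv)
    then have "last (X_max_tree v s) \<le> last (X_max_tree v t)" using l pre by auto
    then show ?thesis
      using strict_prefix_lexord[OF X_max_tree_strict_prefix[OF v s t pre(2)]] ne'
      by (auto simp: prec_def)
  next
    case lex
    \<comment> \<open>Being larger than \<open>s ! i\<close>, the entry \<open>t ! i\<close> is
      positive; hence so is the common last entry, and its image does not depend on the
      position.\<close>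
    have "t ! i \<le> last t" using t lex by (simp add: nd_le_def sorted_nth_le_last)
    then have "last t \<noteq> 0" using lex by simp
    then have "last (X_max_tree v s) = last (X_max_tree v t)" using l lex by simp
    moreover have "(X_max_tree v s, X_max_tree v t) \<in> lexord {(a, b). a < b}"
      unfolding lexord_take_index_conv
    proof (intro disjI2 exI conjI)
      show "i < min (length (X_max_tree v s)) (length (X_max_tree v t))"
        using lex s t v by simp
      have "s ! j = t ! j" if "j < i" for j using lex(4) that by (metis nth_take)
      then show "take i (X_max_tree v s) = take i (X_max_tree v t)"
        using lex s t v by (intro nth_equalityI) (auto simp: nth_X_max_tree)
      have "v ! i \<le> last v"
        using v s lex by (intro sorted_nth_le_last) (auto simp: nd_def nd_le_def)
      then show "(X_max_tree v s ! i, X_max_tree v t ! i) \<in> {(a, b). a < b}"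
        using lex s t v by (auto simp: nth_X_max_tree)
    qed
    ultimately show ?thesis using ne' by (simp add: prec_def)
  qed
qed

lemma X_max_in_E_space:
  assumes v: "v \<in> nd k"
  shows "X_max k v \<in> E_space k"
proof -
  have "E_tree k (X_max_tree v)"
    unfolding E_tree_def
    by (intro conjI ballI impI image_subsetI X_max_tree_in_nd_le[OF v] X_max_tree_prec[OF v]
        X_max_tree_strict_prefix[OF v])
  then show ?thesis by (auto simp: E_space_def X_max_def)
qed

text \<open>\<open>v\<close> is the image of the zero sequence, the least element of
  \<open>nd k\<close>, and the tree preserves the order.\<close>

lemma X_max_ge:
  assumes v: "v \<in> nd k" and k: "k \<ge> 1" and w: "w \<in> X_max k v"
  shows "v = w \<or> v \<prec> w"
proof -
  obtain ms where ms: "ms \<in> nd k" "w = X_max_tree v ms" using w by (auto simp: X_max_def)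
  define z where "z = replicate k (0::nat)"
  have z: "z \<in> nd k" by (simp add: z_def nd_def)
  have fz: "X_max_tree v z = v"
    using v z nd_subset_nd_le[of k]
    by (intro nth_equalityI) (auto simp: nth_X_max_tree nd_def z_def subset_iff)
  have "z = ms \<or> z \<prec> ms"
  proof (cases "last ms = 0")
    case True
    then have "ms ! i = 0" if "i < k" for i
      using sorted_nth_le_last[of ms i] ms that by (simp add: nd_def)
    then have "z = ms" using ms by (intro nth_equalityI) (auto simp: z_def nd_def)
    then show ?thesis ..
  next
    case False
    then show ?thesis using k ms by (auto simp: prec_def z_def nd_def)
  qed
  then show ?thesis
    using X_max_tree_prec[of v k z ms] v z ms fz nd_subset_nd_le[of k] by auto
qed

lemma self_in_X_max:
  assumes v: "v \<in> nd k"
  shows "v \<in> X_max k v"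
proof -
  have "X_max_tree v (replicate k 0) = v"
    using v nd_subset_nd_le[of k]
    by (intro nth_equalityI) (auto simp: X_max_tree_def nd_def)
  then show ?thesis unfolding X_max_def
    by (intro image_eqI[where x = "replicate k 0"]) (auto simp: nd_def)
qed

text \<open>The trees compose: for \<open>v = X_max_tree u m\<close>, the tree of \<open>v\<close>
  at \<open>n\<close> is the tree of \<open>u\<close> at \<open>X_max_tree m n\<close>. This nesting
  lets an initial segment of one set \<open>X_max k u\<close> hold the supports of many
  blocks.\<close>

lemma X_max_mono:
  assumes u: "u \<in> nd k" and k: "k \<ge> 1" and v: "v \<in> X_max k u"
  shows "X_max k v \<subseteq> X_max k u"
proof
  fix w assume "w \<in> X_max k v"
  then obtain n where n: "n \<in> nd k" and w: "w = X_max_tree v n" by (auto simp: X_max_def)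
  obtain m where m: "m \<in> nd k" and v_eq: "v = X_max_tree u m" using v by (auto simp: X_max_def)
  have vn: "v \<in> nd k" using v u X_max_subset_nd by blast
  note le = subsetD[OF nd_subset_nd_le[of k]]
  have len: "length m = k" "length n = k" "length u = k" using m n u by (auto simp: nd_def)
  \<comment> \<open>This covers \<open>last m = 0\<close> too: \<open>m\<close> has full length
    \<open>k\<close>, so that zero is at the last position and goes to
    \<open>last u\<close>.\<close>
  have lastv: "last v = last u + last m"
  proof -
    have "m \<noteq> []" "u \<noteq> []" using k len by auto
    then have "m \<noteq> []" "last u = u ! (length m - 1)" using len by (simp_all add: last_conv_nth)
    then show ?thesis using last_X_max_tree[OF u le[OF m]] by (simp add: v_eq)
  qed
  define l where "l = map2 (\<lambda>a b. if b = 0 then a else last m + b) m n"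
  have "l = X_max_tree m n" by (simp add: l_def X_max_tree_def)
  then have l: "l \<in> nd k" using m n by (simp add: X_max_tree_in_nd)
  have "w = X_max_tree u l"
    using len lastv u vn l n m
    by (intro nth_equalityI)
       (auto simp: w nth_X_max_tree[OF _ le] v_eq l_def length_X_max_tree[OF _ le])
  then show "w \<in> X_max k u" using l by (auto simp: X_max_def)
qed

section \<open>Initial segments as members of \<open>AR k\<close>\<close>

lemma card_below_less:
  assumes "x \<in> X" "x \<prec> w" "finite {y \<in> X. y \<prec> w}"
  shows "card {y \<in> X. y \<prec> x} < card {y \<in> X. y \<prec> w}"
proof (rule psubset_card_mono[OF assms(3)])
  have "y \<prec> w" if "y \<prec> x" for y using prec_trans[OF that assms(2)] .
  moreover have "x \<notin> {y \<in> X. y \<prec> x}" using prec_irrefl by simp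
  moreover have "x \<in> {y \<in> X. y \<prec> w}" using assms by simp
  ultimately show "{y \<in> X. y \<prec> x} \<subset> {y \<in> X. y \<prec> w}" by auto
qed

text \<open>\<open>r\<close> selects by the number of predecessors, so the points below
  \<open>w\<close> form \<open>r n X\<close> with \<open>n\<close> the number of predecessors of
  \<open>w\<close>. The point \<open>u\<close> is one of them, which gives
  \<open>n \<ge> 1\<close>.\<close>

lemma X_max_below_in_AR:
  assumes u: "u \<in> nd k" and w: "w \<in> X_max k u" and uw: "u \<prec> w"
  shows "{y \<in> X_max k u. y \<prec> w} \<in> AR k"
proof -
  define X where "X = X_max k u"
  have fin: "finite {y \<in> X. y \<prec> x}" for x
    using finite_prec_below[of k x] X_max_subset_nd[OF u]
    by (rule_tac finite_subset) (auto simp: X_def)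
  define n where "n = card {y \<in> X. y \<prec> w}"
  have "u \<in> {y \<in> X. y \<prec> w}" using self_in_X_max[OF u] uw by (simp add: X_def)
  then have "n \<ge> 1" using fin[of w] unfolding n_def by (metis One_nat_def Suc_leI card_gt_0_iff empty_iff)
  have "card {y \<in> X. y \<prec> x} < n \<longleftrightarrow> x \<prec> w" if x: "x \<in> X" for x
  proof
    assume "x \<prec> w"
    then show "card {y \<in> X. y \<prec> x} < n" unfolding n_def by (intro card_below_less x fin)
  next
    assume less: "card {y \<in> X. y \<prec> x} < n"
    show "x \<prec> w"
    proof (rule ccontr)
      assume "\<not> x \<prec> w"
      then have "w = x \<or> w \<prec> x" using prec_linear[of x w] by auto
      then have "{y \<in> X. y \<prec> w} \<subseteq> {y \<in> X. y \<prec> x}" using prec_trans[of _ w x] by auto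
      from card_mono[OF fin this] less show False by (simp add: n_def)
    qed
  qed
  then have "{y \<in> X. y \<prec> w} = r n X" by (auto simp: r_def)
  moreover have "r n X \<in> AR k"
    using X_max_in_E_space[OF u] \<open>n \<ge> 1\<close> by (auto simp: AR_def X_def)
  ultimately show ?thesis by (simp add: X_def)
qed

text \<open>\<open>admissible\<close> compares neighbours only; passing to arbitrary pairs requires
  a point in each set in between. An element of \<open>X\<close> with the fewest predecessors has
  none at all, since these numbers strictly increase along the order.\<close>

lemma AR_nonempty:
  assumes "E \<in> AR k"
  shows "E \<noteq> {}"
proof -
  obtain n X where E: "E = r n X" "n \<ge> 1" and X: "X \<in> E_space k"
    using assms unfolding AR_def by blast
  obtain f where f: "X = f ` nd k" "E_tree k f" using X unfolding E_space_def by blast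
  have sub: "X \<subseteq> nd_le k" 
    unfolding f(1) using conjunct1[OF f(2)[unfolded E_tree_def]] image_mono[OF nd_subset_nd_le[of k], of f]
    by (rule order_trans[rotated])
  have "replicate k 0 \<in> nd k" by (simp add: nd_def)
  then have ne: "X \<noteq> {}" using f by auto
  \<comment> \<open>\<open>X\<close> is only known here to lie in \<open>nd_le k\<close>, so
    predecessors are collected length by length.\<close>
  have fin: "finite {y \<in> X. y \<prec> x}" for x
  proof (rule finite_subset)
    show "{y \<in> X. y \<prec> x} \<subseteq> (\<Union>i\<le>k. {y \<in> nd i. y \<prec> x})" using sub by (auto simp: nd_le_def nd_def)
  qed (simp add: finite_prec_below)
  define P where "P x = card {y \<in> X. y \<prec> x}" for x
  obtain x where x: "x \<in> X" "\<And>y. y \<in> X \<Longrightarrow> P x \<le> P y"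
    using ne ex_has_least_nat[of "\<lambda>x. x \<in> X" _ P] by auto
  have "{y \<in> X. y \<prec> x} = {}"
  proof (rule ccontr)
    assume "{y \<in> X. y \<prec> x} \<noteq> {}"
    then obtain y where y: "y \<in> X" "y \<prec> x" by blast
    then have "P y < P x" unfolding P_def by (intro card_below_less fin)
    with x(2)[OF y(1)] show False by simp
  qed
  then have "card {y \<in> X. y \<prec> x} = 0" by (simp only: card.empty)
  then have "x \<in> r n X" using x(1) E(2) by (auto simp: r_def)
  then show ?thesis using E by blast
qed

section \<open>The norm\<close>

lemma restr_c00: "x \<in> c00 k \<Longrightarrow> restr A x \<in> c00 k"
  by (auto simp: c00_def restr_def supp_def elim!: rev_finite_subset)

lemma supp_restr: "supp (restr A x) = supp x \<inter> A"
  by (auto simp: supp_def restr_def)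

lemma restr_Int_supp: "restr (A \<inter> supp x) x = restr A x"
  by (auto simp: restr_def supp_def)

lemma set_less_trans: "set_less A B \<Longrightarrow> set_less B C \<Longrightarrow> B \<noteq> {} \<Longrightarrow> set_less A C"
  unfolding set_less_def using prec_trans by (meson ex_in_conv)

lemma set_less_disjoint: "set_less A B \<Longrightarrow> A \<inter> B = {}"
  unfolding set_less_def using prec_irrefl by blast

lemma admissible_set_less:
  assumes adm: "admissible k d m E" and "i < j" "j < m"
  shows "set_less (E i) (E j)"
  using assms(2,3)
proof (induction j)
  case (Suc j)
  then have step: "set_less (E j) (E (Suc j))" and ne: "E j \<noteq> {}"
    using adm AR_nonempty[of "E j" k] by (auto simp: admissible_def)
  show ?case
  proof (cases "i = j")
    case False
    then have "set_less (E i) (E j)" using Suc by simp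
    then show ?thesis using set_less_trans step ne by blast
  qed (use step in simp)
qed simp

lemma AR_ex:
  assumes "k \<ge> 1"
  obtains E where "E \<in> AR k"
proof -
  have "replicate k 0 \<in> nd k" by (simp add: nd_def)
  then have "X_max k (replicate k 0) \<in> E_space k" by (rule X_max_in_E_space)
  then have "r 1 (X_max k (replicate k 0)) \<in> AR k" unfolding AR_def by blast
  then show thesis by (rule that)
qed

locale T_space =
  fixes k d :: nat and \<theta> :: real
  assumes k: "k \<ge> 1" and d: "d \<ge> 1" and \<theta>_pos: "0 < \<theta>" and \<theta>_less: "\<theta> < 1"
begin

abbreviation level :: "nat \<Rightarrow> (nat list \<Rightarrow> real) \<Rightarrow> real" where
  "level \<equiv> T_level k d \<theta>"

abbreviation N :: "(nat list \<Rightarrow> real) \<Rightarrow> real" where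
  "N \<equiv> T_norm k d \<theta>"

definition admissible_sums :: "nat \<Rightarrow> (nat list \<Rightarrow> real) \<Rightarrow> real set" where
  "admissible_sums j x =
     {\<Sum>i<m. level j (restr (E i) x) | m E. 1 \<le> m \<and> m \<le> d \<and> admissible k d m E}"

lemma level_Suc: "level (Suc j) x = max (level j x) (\<theta> * Max (admissible_sums j x))"
  by (simp add: admissible_sums_def)

text \<open>Infinitely many families compete, but a summand depends only on the trace
  \<open>E i \<inter> supp x\<close>. So each sum is that of a list of length at most
  \<open>d\<close> over the finite set of values \<open>V\<close>.\<close>

lemma finite_admissible_sums:
  assumes x: "x \<in> c00 k"
  shows "finite (admissible_sums j x)"
proof (rule finite_subset)
  define V where "V = (\<lambda>A. level j (restr A x)) ` Pow (supp x)"
  have "finite V" using x by (simp add: V_def c00_def)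
  then show "finite (sum_list ` {ys. set ys \<subseteq> V \<and> length ys \<le> d})"
    by (simp add: finite_lists_length_le)
  show "admissible_sums j x \<subseteq> sum_list ` {ys. set ys \<subseteq> V \<and> length ys \<le> d}"
  proof
    fix s assume "s \<in> admissible_sums j x"
    then obtain m E where m: "m \<le> d" and s: "s = (\<Sum>i<m. level j (restr (E i) x))"
      unfolding admissible_sums_def by blast
    define ys where "ys = map (\<lambda>i. level j (restr (E i) x)) [0..<m]"
    have "level j (restr (E i) x) \<in> V" for i
      unfolding V_def by (intro image_eqI[where x = "E i \<inter> supp x"]) (auto simp: restr_Int_supp)
    then have "ys \<in> {ys. set ys \<subseteq> V \<and> length ys \<le> d}" using m by (auto simp: ys_def)
    moreover have "s = sum_list ys"
      by (simp add: ys_def s interv_sum_list_conv_sum_set_nat atLeast0LessThan)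
    ultimately show "s \<in> sum_list ` {ys. set ys \<subseteq> V \<and> length ys \<le> d}" by blast
  qed
qed

lemma admissible_sums_nonempty: "admissible_sums j x \<noteq> {}"
proof -
  obtain E where "E \<in> AR k" using AR_ex[OF k] .
  then have "admissible k d 1 (\<lambda>_. E)" using d by (simp add: admissible_def)
  then show ?thesis using d unfolding admissible_sums_def by blast
qed

lemma level_le_Suc: "level j x \<le> level (Suc j) x"
  by simp

lemma admissible_le_level_Suc:
  assumes "x \<in> c00 k" "1 \<le> m" "admissible k d m E"
  shows "\<theta> * (\<Sum>i<m. level j (restr (E i) x)) \<le> level (Suc j) x"
proof -
  have "m \<le> d" using assms(3) by (simp add: admissible_def)
  then have "(\<Sum>i<m. level j (restr (E i) x)) \<in> admissible_sums j x"
    using assms(2,3) unfolding admissible_sums_def by blast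
  then have "(\<Sum>i<m. level j (restr (E i) x)) \<le> Max (admissible_sums j x)"
    by (intro Max_ge finite_admissible_sums assms(1))
  then show ?thesis using \<theta>_pos unfolding level_Suc by (simp add: le_max_iff_disj)
qed

lemma level_Suc_cases:
  assumes x: "x \<in> c00 k"
  obtains (same) "level (Suc j) x = level j x"
    | (sum) m E where "1 \<le> m" "admissible k d m E"
        "level (Suc j) x = \<theta> * (\<Sum>i<m. level j (restr (E i) x))"
proof -
  have "Max (admissible_sums j x) \<in> admissible_sums j x"
    by (intro Max_in finite_admissible_sums admissible_sums_nonempty x)
  then obtain m E where "1 \<le> m" "admissible k d m E"
    "Max (admissible_sums j x) = (\<Sum>i<m. level j (restr (E i) x))"
    unfolding admissible_sums_def by blast
  then show thesis using same sum unfolding level_Suc max_def by metis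
qed

lemma level_0_finite: "x \<in> c00 k \<Longrightarrow> finite {\<bar>x v\<bar> | v. v \<in> nd k}"
  by (rule finite_subset[of _ "insert 0 ((\<lambda>v. \<bar>x v\<bar>) ` supp x)"]) (auto simp: supp_def c00_def)

lemma abs_le_level_0:
  assumes "x \<in> c00 k"
  shows "\<bar>x v\<bar> \<le> level 0 x"
proof -
  have rep: "replicate k 0 \<in> nd k" by (simp add: nd_def)
  have ge: "\<bar>x u\<bar> \<le> level 0 x" if "u \<in> nd k" for u
    using that level_0_finite[OF assms] by (auto intro!: Max_ge)
  show ?thesis
  proof (cases "v \<in> nd k")
    case False
    then have "x v = 0" using assms by (auto simp: c00_def supp_def)
    then show ?thesis using ge[OF rep] by linarith
  qed (rule ge)
qed

lemma level_0_attained: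
  assumes "x \<in> c00 k"
  obtains v where "v \<in> nd k" "level 0 x = \<bar>x v\<bar>"
proof -
  have rep: "replicate k 0 \<in> nd k" by (simp add: nd_def)
  then have "level 0 x \<in> {\<bar>x v\<bar> | v. v \<in> nd k}"
    unfolding T_level.simps by (intro Max_in level_0_finite assms) blast
  then show thesis using that by blast
qed

lemma level_mono_index: "i \<le> j \<Longrightarrow> level i x \<le> level j x"
  by (rule lift_Suc_mono_le[of "\<lambda>j. level j x", OF level_le_Suc])

lemma level_nonneg:
  assumes "x \<in> c00 k"
  shows "0 \<le> level j x"
  \<comment> \<open>\<open>undefined\<close> stands for an arbitrary list; any single absolute value
    shows that level \<open>0\<close> is nonnegative.\<close>
  using level_mono_index[of 0 j x] abs_le_level_0[OF assms, of undefined] by linarith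

lemma level_mono:
  assumes "x \<in> c00 k" "y \<in> c00 k" "\<And>v. \<bar>x v\<bar> \<le> \<bar>y v\<bar>"
  shows "level j x \<le> level j y"
  using assms
proof (induction j arbitrary: x y)
  case 0
  obtain v where "level 0 x = \<bar>x v\<bar>" using level_0_attained[OF 0(1)] by blast
  then show ?case using 0(3)[of v] abs_le_level_0[OF 0(2), of v] by linarith
next
  case (Suc j)
  show ?case
  proof (cases rule: level_Suc_cases[OF Suc.prems(1), of j, case_names same sum])
    case same
    then show ?thesis using Suc.IH[OF Suc.prems] level_le_Suc[of j y] by linarith
  next
    case (sum m E)
    have "(\<Sum>i<m. level j (restr (E i) x)) \<le> (\<Sum>i<m. level j (restr (E i) y))"
      using Suc.prems by (intro sum_mono Suc.IH restr_c00) (auto simp: restr_def)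
    then have "\<theta> * (\<Sum>i<m. level j (restr (E i) x)) \<le> \<theta> * (\<Sum>i<m. level j (restr (E i) y))"
      using \<theta>_pos by simp
    also have "\<dots> \<le> level (Suc j) y" using sum Suc.prems by (intro admissible_le_level_Suc)
    finally show ?thesis using sum by simp
  qed
qed

text \<open>Restrictions to an admissible family have disjoint supports and
  \<open>\<theta> < 1\<close>, so the bound passes from level to level. Being independent of
  \<open>j\<close>, it makes the supremum in \<open>T_norm\<close> finite.\<close>

lemma level_le_l1:
  assumes "x \<in> c00 k"
  shows "level j x \<le> (\<Sum>v\<in>supp x. \<bar>x v\<bar>)"
  using assms
proof (induction j arbitrary: x)
  case 0
  have fin: "finite (supp x)" using 0 by (simp add: c00_def)
  obtain v where v: "level 0 x = \<bar>x v\<bar>" using level_0_attained[OF 0] by blast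
  show ?case
  proof (cases "v \<in> supp x")
    case True
    then show ?thesis using v fin member_le_sum[of v "supp x" "\<lambda>v. \<bar>x v\<bar>"] by simp
  next
    case False
    then show ?thesis using v by (simp add: supp_def sum_nonneg del: T_level.simps)
  qed
next
  case (Suc j)
  have fin: "finite (supp x)" using Suc by (simp add: c00_def)
  show ?case
  proof (cases rule: level_Suc_cases[OF Suc.prems, of j, case_names same sum])
    case same
    then show ?thesis using Suc.IH[OF Suc.prems] by linarith
  next
    case (sum m E)
    define A where "A i = supp x \<inter> E i" for i
    have dis: "A i \<inter> A i' = {}" if "i < m" "i' < m" "i \<noteq> i'" for i i'
      using that admissible_set_less[OF sum(2), of i i'] admissible_set_less[OF sum(2), of i' i]
      by (cases "i < i'") (auto simp: A_def dest!: set_less_disjoint)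
    have "(\<Sum>i<m. level j (restr (E i) x)) \<le> (\<Sum>i<m. \<Sum>v\<in>A i. \<bar>x v\<bar>)"
    proof (rule sum_mono)
      fix i
      have "level j (restr (E i) x) \<le> (\<Sum>v\<in>A i. \<bar>restr (E i) x v\<bar>)"
        using Suc.IH[OF restr_c00[OF Suc.prems]] by (simp add: supp_restr A_def)
      then show "level j (restr (E i) x) \<le> (\<Sum>v\<in>A i. \<bar>x v\<bar>)"
        by (simp add: A_def restr_def)
    qed
    also have "\<dots> = (\<Sum>v\<in>(\<Union>i<m. A i). \<bar>x v\<bar>)"
      using fin dis by (intro sum.UNION_disjoint[symmetric]) (auto simp: A_def)
    also have "\<dots> \<le> (\<Sum>v\<in>supp x. \<bar>x v\<bar>)"
      using fin by (intro sum_mono2) (auto simp: A_def)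
    finally have "\<theta> * (\<Sum>i<m. level j (restr (E i) x)) \<le> 1 * (\<Sum>v\<in>supp x. \<bar>x v\<bar>)"
      using \<theta>_pos \<theta>_less by (intro mult_mono) (auto intro!: sum_nonneg level_nonneg restr_c00 Suc.prems)
    then show ?thesis using sum by simp
  qed
qed

lemma scale_c00: "x \<in> c00 k \<Longrightarrow> (\<lambda>v. c * x v) \<in> c00 k"
  by (auto simp: c00_def supp_def elim!: rev_finite_subset)

lemma level_scale_ge:
  assumes "x \<in> c00 k"
  shows "\<bar>c\<bar> * level j x \<le> level j (\<lambda>v. c * x v)"
  using assms
proof (induction j arbitrary: x)
  case 0
  obtain v where "level 0 x = \<bar>x v\<bar>" using level_0_attained[OF 0] by blast
  then show ?case using abs_le_level_0[OF scale_c00[OF 0], of c v] by (simp add: abs_mult)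
next
  case (Suc j)
  show ?case
  proof (cases rule: level_Suc_cases[OF Suc.prems, of j, case_names same sum])
    case same
    show ?thesis
      unfolding same by (rule order_trans[OF Suc.IH[OF Suc.prems] level_le_Suc])
  next
    case (sum m E)
    have restr: "(\<lambda>v. c * restr A x v) = restr A (\<lambda>v. c * x v)" for A by (auto simp: restr_def)
    have "\<bar>c\<bar> * level (Suc j) x = \<theta> * (\<Sum>i<m. \<bar>c\<bar> * level j (restr (E i) x))"
      using sum(3) by (simp add: sum_distrib_left mult_ac del: T_level.simps)
    also have "\<dots> \<le> \<theta> * (\<Sum>i<m. level j (restr (E i) (\<lambda>v. c * x v)))"
      using \<theta>_pos Suc.IH[OF restr_c00[OF Suc.prems]]
      by (intro mult_left_mono sum_mono) (auto simp: restr)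
    also have "\<dots> \<le> level (Suc j) (\<lambda>v. c * x v)"
      using sum by (intro admissible_le_level_Suc scale_c00 Suc.prems)
    finally show ?thesis .
  qed
qed

section \<open>From the levels to the norm\<close>

lemma bdd_above_level: "x \<in> c00 k \<Longrightarrow> bdd_above (range (\<lambda>j. level j x))"
  using level_le_l1[of x] by (auto simp: bdd_above_def)

lemma level_le_N: "x \<in> c00 k \<Longrightarrow> level j x \<le> N x"
  unfolding T_norm_def by (intro cSUP_upper bdd_above_level) auto

lemma N_leI: "(\<And>j. level j x \<le> C) \<Longrightarrow> N x \<le> C"
  unfolding T_norm_def by (intro cSUP_least) auto

lemma N_nonneg: "x \<in> c00 k \<Longrightarrow> 0 \<le> N x"
  using level_nonneg[of x 0] level_le_N[of x 0] by linarith

lemma N_mono: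
  assumes "x \<in> c00 k" "y \<in> c00 k" "\<And>v. \<bar>x v\<bar> \<le> \<bar>y v\<bar>"
  shows "N x \<le> N y"
  using level_mono[OF assms] level_le_N[OF assms(2)] by (intro N_leI) (meson order_trans)

lemma abs_le_N: "x \<in> c00 k \<Longrightarrow> \<bar>x v\<bar> \<le> N x"
  using abs_le_level_0 level_le_N order_trans by meson

lemma N_scale_ge:
  assumes "x \<in> c00 k"
  shows "\<bar>c\<bar> * N x \<le> N (\<lambda>v. c * x v)"
proof (cases "c = 0")
  case True
  have "(\<lambda>v. 0) \<in> c00 k" by (simp add: c00_def supp_def)
  then show ?thesis using N_nonneg True by simp
next
  case False
  have "\<bar>c\<bar> * level j x \<le> N (\<lambda>v. c * x v)" for j
    
    using level_scale_ge[OF assms] level_le_N[OF scale_c00[OF assms]] order_trans by meson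
  then have "N x \<le> N (\<lambda>v. c * x v) / \<bar>c\<bar>"
    using False by (intro N_leI) (simp add: pos_le_divide_eq mult.commute)
  then show ?thesis using False by (simp add: pos_le_divide_eq mult.commute)
qed

lemma level_tendsto_N:
  assumes "x \<in> c00 k"
  shows "(\<lambda>j. level j x) \<longlonglongrightarrow> N x"
  unfolding T_norm_def
  by (intro LIMSEQ_incseq_SUP bdd_above_level assms incseq_SucI level_le_Suc)

text \<open>The summands attain their suprema at different levels, if at all. As the levels
  increase, they converge to the norm, and the inequality for one level passes to the limit.\<close>

lemma admissible_le_N:
  assumes x: "x \<in> c00 k" and "1 \<le> m" "admissible k d m E"
  shows "\<theta> * (\<Sum>i<m. N (restr (E i) x)) \<le> N x"
proof (rule LIMSEQ_le_const2)
  show "(\<lambda>j. \<theta> * (\<Sum>i<m. level j (restr (E i) x))) \<longlonglongrightarrow> \<theta> * (\<Sum>i<m. N (restr (E i) x))"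
    by (intro tendsto_intros level_tendsto_N restr_c00 x)
  have "\<theta> * (\<Sum>i<m. level j (restr (E i) x)) \<le> N x" for j
    using admissible_le_level_Suc[OF assms] level_le_N[OF x] order_trans by meson
  then show "\<exists>n0. \<forall>j\<ge>n0. \<theta> * (\<Sum>i<m. level j (restr (E i) x)) \<le> N x" by blast
qed

text \<open>Both estimates discard empty members of a family, which leaves an arbitrary finite index
  set \<open>R\<close>; its sorted list restores the consecutive indices.\<close>

lemma indexed_admissible_le_N:
  fixes R :: "nat set"
  assumes x: "x \<in> c00 k" and R: "finite R" "card R \<le> d"
    and AR: "\<And>i. i \<in> R \<Longrightarrow> E i \<in> AR k"
    and less: "\<And>i j. i \<in> R \<Longrightarrow> j \<in> R \<Longrightarrow> i < j \<Longrightarrow> set_less (E i) (E j)"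
  shows "\<theta> * (\<Sum>i\<in>R. N (restr (E i) x)) \<le> N x"
proof (cases "R = {}")
  case True
  then show ?thesis using N_nonneg[OF x] by simp
next
  case False
  define l where "l = sorted_list_of_set R"
  have len: "length l = card R" and set: "set l = R" and dis: "distinct l" and sor: "sorted_wrt (<) l"
    using R by (simp_all add: l_def)
  have "bij_betw (\<lambda>i. l ! i) {..<card R} R"
    using bij_betw_nth[OF dis] set len by simp
  then have eq: "(\<Sum>i\<in>R. N (restr (E i) x)) = (\<Sum>i<card R. N (restr (E (l ! i)) x))"
    by (rule sum.reindex_bij_betw[symmetric])
  have "admissible k d (card R) (\<lambda>i. E (l ! i))"
    unfolding admissible_def
  proof (intro conjI allI impI)
    fix i assume "i < card R"
    then have "l ! i \<in> R" using set len nth_mem by metis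
    then show "E (l ! i) \<in> AR k" by (rule AR)
  next
    fix i assume i: "Suc i < card R"
    then have "l ! i \<in> R" "l ! Suc i \<in> R" using set len nth_mem Suc_lessD by metis+
    moreover have "l ! i < l ! Suc i" using sor i len by (simp add: sorted_wrt_nth_less)
    ultimately show "set_less (E (l ! i)) (E (l ! Suc i))" by (rule less)
  qed (rule R)
  moreover have "1 \<le> card R" using R False by (simp add: Suc_le_eq card_gt_0_iff)
  ultimately show ?thesis unfolding eq by (intro admissible_le_N x)
qed

end

section \<open>Estimates in \<open>\<ell>\<^sub>p\<close>\<close>

lemma weighted_Holder_bound:
  fixes p :: real
  assumes p: "1 < p" and J: "finite J"
    and b: "\<And>i. i \<in> J \<Longrightarrow> 0 \<le> b i" and m: "\<And>i. i \<in> J \<Longrightarrow> 0 \<le> m i" and sum_m: "sum m J \<le> 1"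
  shows "(\<Sum>i\<in>J. b i * m i powr (1 - 1 / p)) \<le> (\<Sum>i\<in>J. b i powr p) powr (1 / p)"
proof -
  define S where "S = (\<Sum>i\<in>J. b i powr p)"
  define q where "q = p / (p - 1)"
  have q: "q > 1" "1 / p + 1 / q = 1" "1 - 1 / p = 1 / q" using p by (auto simp: q_def field_simps)
  show ?thesis
  proof (cases "S = 0")
    case True
    then have "b i = 0" if "i \<in> J" for i
      using J that by (simp add: S_def sum_nonneg_eq_0_iff)
    then show ?thesis by simp
  next
    case False
    then have S: "S > 0" by (simp add: S_def sum_nonneg order_less_le)
    \<comment> \<open>Dividing by \<open>T\<close> makes the \<open>p\<close>-th powers sum to
      \<open>1\<close>, and the exponent \<open>1 / q\<close> makes the \<open>q\<close>-th powers
      of the other factors the masses themselves, with sum at most \<open>1\<close>. Young's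
      inequality can then be added up termwise.\<close>
    define T where "T = S powr (1 / p)"
    have T: "T > 0" "T powr p = S" using S p by (simp_all add: T_def powr_powr)
    have "(b i / T) * m i powr (1 / q) \<le> b i powr p / S / p + m i / q" if i: "i \<in> J" for i
    proof -
      have "(b i / T) * m i powr (1 / q) \<le> (b i / T) powr p / p + (m i powr (1 / q)) powr q / q"
        using p q b[OF i] T by (intro Youngs_inequality) auto
      then show ?thesis using p q b[OF i] m[OF i] T by (simp add: powr_divide powr_powr)
    qed
    then have "(\<Sum>i\<in>J. (b i / T) * m i powr (1 / q)) \<le> (\<Sum>i\<in>J. b i powr p / S / p + m i / q)"
      by (intro sum_mono)
    also have "\<dots> = 1 / p + sum m J / q"
      using S by (simp add: sum.distrib S_def flip: sum_divide_distrib)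
    also have "\<dots> \<le> 1" using q sum_m by (smt (verit) divide_right_mono)
    finally have "(\<Sum>i\<in>J. b i * m i powr (1 / q)) / T \<le> 1" by (simp add: sum_divide_distrib)
    then show ?thesis using T q(3) by (simp add: pos_divide_le_eq T_def S_def)
  qed
qed

text \<open>In a \<open>d\<close>-adic cell of level \<open>n\<close> containing some \<open>c i\<close> with \<open>l i + 1 \<le> n\<close> there is no other
  point, by separation, so truncated subtraction gives the exponent \<open>0\<close> wanted there. All
  other cells split into \<open>d\<close> cells of level \<open>n + 1\<close>.\<close>

lemma d_adic_cell_lower_bound:
  fixes M :: "nat set \<Rightarrow> real" and b c :: "nat \<Rightarrow> real" and d :: nat
  assumes J: "finite J" and d: "1 \<le> d" and \<theta>: "0 < \<theta>"
    and single: "\<And>i. i \<in> J \<Longrightarrow> b i \<le> M {i}"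
    and empty: "0 \<le> M {}"
    and super: "\<And>J' h. J' \<subseteq> J \<Longrightarrow> h ` J' \<subseteq> {..<d} \<Longrightarrow> mono_on J' h \<Longrightarrow>
        \<theta> * (\<Sum>s<d. M {i \<in> J'. h i = s}) \<le> M J'"
    and mono: "mono_on J c"
    and sep: "\<And>i j. i \<in> J \<Longrightarrow> j \<in> J \<Longrightarrow> i \<noteq> j \<Longrightarrow> 1 \<le> \<bar>c i - c j\<bar> * d ^ (l i + 1)"
  defines "cell n t \<equiv> {i \<in> J. \<lfloor>c i * d ^ n\<rfloor> = t}"
  shows "(\<Sum>i\<in>cell n t. \<theta> ^ (l i + 1 - n) * b i) \<le> M (cell n t)"
proof -
  \<comment> \<open>The induction goes from deep cells to shallow ones: from level \<open>K\<close>
    on, every nonempty cell falls under the case \<open>small\<close>.\<close>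
  define K where "K = Max (insert 0 (l ` J)) + 1"
  have K: "l i < K" if "i \<in> J" for i using J that by (simp add: K_def less_Suc_eq_le)
  show ?thesis
  proof (induction "K - n" arbitrary: n t rule: less_induct)
    case less
    have sub: "cell n t \<subseteq> J" and fin: "finite (cell n t)" using J by (auto simp: cell_def)
    consider (small) i where "i \<in> cell n t" "l i + 1 \<le> n" | (empty) "cell n t = {}"
      | (large) "cell n t \<noteq> {}" "\<And>i. i \<in> cell n t \<Longrightarrow> n < l i + 1"
      by (meson not_le)
    then show ?case
    proof cases
      case small
      have "j = i" if j: "j \<in> cell n t" for j
      proof (rule ccontr)
        assume "j \<noteq> i"
        have "1 \<le> \<bar>c i - c j\<bar> * d ^ (l i + 1)"
          using sep small j sub \<open>j \<noteq> i\<close> by blast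
        also have "\<dots> \<le> \<bar>c i - c j\<bar> * d ^ n"
        proof (rule mult_left_mono)
          have "d ^ (l i + 1) \<le> d ^ n" using small d by (intro power_increasing) auto
          then show "real (d ^ (l i + 1)) \<le> real (d ^ n)" by (simp only: of_nat_le_iff)
        qed simp
        also have "\<dots> = \<bar>c i * d ^ n - c j * d ^ n\<bar>"
          by (simp add: abs_mult flip: left_diff_distrib)
        also have "\<dots> < 1"
          using small j unfolding cell_def by clarsimp linarith
        finally show False by simp
      qed
      then have "cell n t = {i}" using small by blast
      then show ?thesis using small single sub by simp
    next
      case empty
      then show ?thesis using assms(5) by simp
    next
      case large
      \<comment> \<open>\<open>h i\<close> is the next base \<open>d\<close> digit of
        \<open>c i\<close>, that is, the position of its subcell inside the cell
        \<open>t\<close>.\<close>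
      define h where "h i = nat (\<lfloor>c i * d ^ Suc n\<rfloor> - int d * t)" for i
      have iff: "(real_of_int t \<le> c i * d ^ n \<and> c i * d ^ n < t + 1) \<longleftrightarrow>
          (real d * t \<le> c i * d ^ Suc n \<and> c i * d ^ Suc n < real d * t + d)" for i
      proof -
        have "real_of_int t \<le> c i * d ^ n \<longleftrightarrow> real d * t \<le> real d * (c i * d ^ n)"
          "c i * d ^ n < t + 1 \<longleftrightarrow> real d * (c i * d ^ n) < real d * (t + 1)"
          using d by simp_all
        then show ?thesis by (simp add: algebra_simps)
      qed
      have bounds: "int d * t \<le> \<lfloor>c i * d ^ Suc n\<rfloor> \<and> \<lfloor>c i * d ^ Suc n\<rfloor> < int d * t + d"
        if "i \<in> cell n t" for i
      proof -
        have "real_of_int t \<le> c i * d ^ n \<and> c i * d ^ n < t + 1"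
          using that by (simp add: cell_def floor_eq_iff)
        then have "real d * t \<le> c i * d ^ Suc n \<and> c i * d ^ Suc n < real d * t + d"
          using iff by blast
        then show ?thesis by (simp add: le_floor_iff floor_less_iff del: power_Suc)
      qed
      have h_lt: "h ` cell n t \<subseteq> {..<d}"
      proof clarify
        fix i assume "i \<in> cell n t"
        from bounds[OF this] show "h i < d" by (simp add: h_def nat_less_iff del: power_Suc)
      qed
      have h_mono: "mono_on (cell n t) h"
      proof (rule mono_onI)
        fix i j assume "i \<in> cell n t" "j \<in> cell n t" "i \<le> j"
        then have "c i \<le> c j" using mono sub by (meson mono_onD subsetD)
        then show "h i \<le> h j" unfolding h_def
          by (intro nat_mono diff_right_mono floor_mono mult_right_mono) auto
      qed
      have split: "{i \<in> cell n t. h i = s} = cell (Suc n) (int d * t + s)" if s: "s < d" for s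
      proof (intro equalityI subsetI)
        fix i assume "i \<in> {i \<in> cell n t. h i = s}"
        then show "i \<in> cell (Suc n) (int d * t + s)"
          using bounds[of i] sub by (auto simp: h_def cell_def simp del: power_Suc)
      next
        fix i assume i: "i \<in> cell (Suc n) (int d * t + s)"
        then have eq: "\<lfloor>c i * d ^ Suc n\<rfloor> = int d * t + s" by (simp add: cell_def del: power_Suc)
        then have "real d * t + s \<le> c i * d ^ Suc n" "c i * d ^ Suc n < real d * t + s + 1"
          by (simp_all add: floor_eq_iff del: power_Suc)
        moreover have "real s + 1 \<le> d" using s by linarith
        ultimately have "real_of_int t \<le> c i * d ^ n \<and> c i * d ^ n < t + 1"
          unfolding iff by linarith
        then have "\<lfloor>c i * d ^ n\<rfloor> = t" by (simp add: floor_eq_iff)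
        then show "i \<in> {i \<in> cell n t. h i = s}" using i eq by (simp add: cell_def h_def del: power_Suc)
      qed
      have "n < K" using large K sub by (metis Suc_eq_plus1 ex_in_conv less_Suc_eq_le order.strict_trans1 subsetD)
      \<comment> \<open>Here \<open>n < l i + 1\<close>, so the subtraction does not truncate and
        one factor \<open>\<theta>\<close> splits off.\<close>
      have "(\<Sum>i\<in>cell n t. \<theta> ^ (l i + 1 - n) * b i) =
          (\<Sum>i\<in>cell n t. \<theta> * (\<theta> ^ (l i + 1 - Suc n) * b i))"
      proof (rule sum.cong)
        fix i assume "i \<in> cell n t"
        then have "l i + 1 - n = Suc (l i + 1 - Suc n)" using large(2)[of i] by simp
        then show "\<theta> ^ (l i + 1 - n) * b i = \<theta> * (\<theta> ^ (l i + 1 - Suc n) * b i)" by simp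
      qed simp
      also have "\<dots> = \<theta> * (\<Sum>s<d. \<Sum>i\<in>{i \<in> cell n t. h i = s}. \<theta> ^ (l i + 1 - Suc n) * b i)"
        by (subst sum.group[OF fin _ h_lt]) (simp_all flip: sum_distrib_left)
      also have "\<dots> \<le> \<theta> * (\<Sum>s<d. M {i \<in> cell n t. h i = s})"
      proof (intro mult_left_mono sum_mono)
        fix s assume "s \<in> {..<d}"
        then show "(\<Sum>i\<in>{i \<in> cell n t. h i = s}. \<theta> ^ (l i + 1 - Suc n) * b i)
            \<le> M {i \<in> cell n t. h i = s}"
          using less[of "Suc n"] \<open>n < K\<close> by (simp add: split)
      qed (use \<theta> in simp)
      also have "\<dots> \<le> M (cell n t)" by (rule super[OF sub h_lt h_mono])
      finally show ?thesis .
    qed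
  qed
qed

text \<open>The least exponent with the first inequality also satisfies the second: its predecessor
  violates the first, and for exponent \<open>0\<close> the bound \<open>\<beta> \<le> 1\<close>
  suffices.\<close>

lemma ex_power_scale:
  fixes \<beta> :: real
  assumes "2 \<le> d" "0 < \<beta>" "\<beta> \<le> 1"
  shows "\<exists>l. 1 / real d ^ l \<le> \<beta> \<and> \<beta> \<le> real d * (1 / real d ^ l)"
proof -
  obtain n where "(1 / real d) ^ n < \<beta>"
    using real_arch_pow_inv[OF assms(2), of "1 / real d"] assms(1) by auto
  then have ex: "1 / real d ^ n \<le> \<beta>" by (simp add: power_divide)
  define l where "l = (LEAST l. 1 / real d ^ l \<le> \<beta>)"
  have "1 / real d ^ l \<le> \<beta>" unfolding l_def by (rule LeastI[of _ n]) (rule ex)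
  moreover have "\<beta> \<le> real d * (1 / real d ^ l)"
  proof (cases l)
    case 0
    then show ?thesis using assms by simp
  next
    case (Suc l')
    then have "\<not> 1 / real d ^ l' \<le> \<beta>" using not_less_Least[of l' "\<lambda>l. 1 / real d ^ l \<le> \<beta>"]
      by (simp add: l_def)
    then show ?thesis using Suc assms by simp
  qed
  ultimately show ?thesis by blast
qed

text \<open>The shares \<open>\<beta> i\<close> act as lengths. Rounded down to powers of
  \<open>1 / d\<close>, they fit into the unit interval as consecutive intervals in the order of
  \<open>J\<close>, and \<open>d\<close>-adic cells isolate their midpoints \<open>c i\<close> by
  depth \<open>l i + 1\<close>.\<close>

lemma superadditive_lower_lp:
  fixes M :: "nat set \<Rightarrow> real" and b :: "nat \<Rightarrow> real" and d :: nat and p :: real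
  assumes J: "finite J" and d: "2 \<le> d" and p: "1 < p" and \<theta>: "\<theta> = real d powr (1 / p - 1)"
    and b: "\<And>i. i \<in> J \<Longrightarrow> 0 < b i"
    and single: "\<And>i. i \<in> J \<Longrightarrow> b i \<le> M {i}"
    and empty: "0 \<le> M {}"
    and super: "\<And>J' h. J' \<subseteq> J \<Longrightarrow> h ` J' \<subseteq> {..<d} \<Longrightarrow> mono_on J' h \<Longrightarrow>
        \<theta> * (\<Sum>s<d. M {i \<in> J'. h i = s}) \<le> M J'"
  shows "\<theta>\<^sup>2 * (\<Sum>i\<in>J. b i powr p) powr (1 / p) \<le> M J"
proof (cases "J = {}")
  case True
  then show ?thesis using empty by simp
next
  case False
  define S where "S = (\<Sum>i\<in>J. b i powr p)"
  have S: "S > 0" unfolding S_def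
  proof (intro sum_pos J False)
    fix i assume "i \<in> J"
    then show "0 < b i powr p" using b[of i] by simp
  qed
  define \<beta> where "\<beta> i = b i powr p / S" for i
  have \<beta>_pos: "0 < \<beta> i" if "i \<in> J" for i using b[OF that] S by (simp add: \<beta>_def)
  have \<beta>_sum: "sum \<beta> J = 1" using S by (simp add: \<beta>_def S_def flip: sum_divide_distrib)
  have \<beta>_le: "\<beta> i \<le> 1" if "i \<in> J" for i
    using member_le_sum[of i J \<beta>] that J \<beta>_pos \<beta>_sum by (auto intro: less_imp_le)
  have "\<forall>i\<in>J. \<exists>l. 1 / real d ^ l \<le> \<beta> i \<and> \<beta> i \<le> real d * (1 / real d ^ l)"
    using ex_power_scale d \<beta>_pos \<beta>_le by blast
  then obtain l where l: "\<And>i. i \<in> J \<Longrightarrow> 1 / real d ^ l i \<le> \<beta> i"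
      "\<And>i. i \<in> J \<Longrightarrow> \<beta> i \<le> real d * (1 / real d ^ l i)"
    by metis
  define w where "w i = 1 / real d ^ l i" for i
  have w_pos: "0 < w i" for i using d by (simp add: w_def)
  \<comment> \<open>Midpoints are at least \<open>w i / 2\<close> apart from \<open>c i\<close> on
    either side, whatever the length of the other interval; \<open>d \<ge> 2\<close> turns this into
    distance \<open>1\<close> at scale \<open>d ^ (l i + 1)\<close>.\<close>
  define c where "c i = (\<Sum>j\<in>{j \<in> J. j < i}. w j) + w i / 2" for i
  have gap: "c i + w i / 2 + w j / 2 \<le> c j" if "i \<in> J" "j \<in> J" "i < j" for i j
  proof -
    have "(\<Sum>j'\<in>{j' \<in> J. j' < i}. w j') + w i = (\<Sum>j'\<in>insert i {j' \<in> J. j' < i}. w j')"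
      using J by simp
    also have "\<dots> \<le> (\<Sum>j'\<in>{j' \<in> J. j' < j}. w j')"
      using J that w_pos by (intro sum_mono2) (auto intro: less_imp_le)
    finally show ?thesis by (simp add: c_def)
  qed
  have c_range: "0 \<le> c i \<and> c i < 1" if i: "i \<in> J" for i
  proof
    show "0 \<le> c i" using w_pos by (simp add: c_def sum_nonneg less_imp_le)
    have "(\<Sum>j\<in>{j \<in> J. j < i}. w j) + w i = (\<Sum>j\<in>insert i {j \<in> J. j < i}. w j)"
      using J by simp
    also have "\<dots> \<le> sum w J"
      using J i w_pos by (intro sum_mono2) (auto intro: less_imp_le)
    also have "\<dots> \<le> sum \<beta> J" using l by (intro sum_mono) (simp add: w_def)
    finally show "c i < 1" using w_pos[of i] \<beta>_sum by (simp add: c_def)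
  qed
  have mono: "mono_on J c"
  proof (rule mono_onI)
    fix i j assume "i \<in> J" "j \<in> J" "i \<le> j"
    then show "c i \<le> c j" using gap[of i j] w_pos[of i] w_pos[of j] by (cases "i = j") auto
  qed
  have sep: "1 \<le> \<bar>c i - c j\<bar> * d ^ (l i + 1)" if "i \<in> J" "j \<in> J" "i \<noteq> j" for i j
  proof -
    have "w i / 2 \<le> \<bar>c i - c j\<bar>"
      using gap[of i j] gap[of j i] that w_pos[of i] w_pos[of j] by (cases "i < j") auto
    then have "w i / 2 * d ^ (l i + 1) \<le> \<bar>c i - c j\<bar> * d ^ (l i + 1)"
      by (intro mult_right_mono) auto
    moreover have "1 \<le> w i / 2 * d ^ (l i + 1)" using d by (simp add: w_def)
    ultimately show ?thesis by linarith
  qed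
  have \<theta>_pos: "0 < \<theta>" using d by (simp add: \<theta>)
  have cell: "{i \<in> J. \<lfloor>c i * real (d ^ 0)\<rfloor> = 0} = J" using c_range by (auto simp: floor_eq_iff)
  have d1: "1 \<le> d" using d by simp
  have "(\<Sum>i\<in>{i \<in> J. \<lfloor>c i * real (d ^ 0)\<rfloor> = 0}. \<theta> ^ (l i + 1 - 0) * b i)
      \<le> M {i \<in> J. \<lfloor>c i * real (d ^ 0)\<rfloor> = 0}"
    by (rule d_adic_cell_lower_bound[OF J d1 \<theta>_pos single empty super mono sep])
  then have "(\<Sum>i\<in>J. \<theta> ^ (l i + 1) * b i) \<le> M J" by (simp only: cell diff_zero)
  moreover have "\<theta>\<^sup>2 * S powr (1 / p) * \<beta> i \<le> \<theta> ^ (l i + 1) * b i" if i: "i \<in> J" for i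
  proof -
    \<comment> \<open>The power \<open>1 - 1 / p\<close> turns the factor \<open>1 / d\<close> into
      \<open>\<theta>\<close>, so \<open>\<beta> i / d \<le> w i\<close> becomes a comparison with
      \<open>\<theta> ^ l i\<close>.\<close>
    have "\<theta> * \<beta> i powr (1 - 1 / p) = (\<beta> i / d) powr (1 - 1 / p)"
      using d \<beta>_pos[OF i] by (simp add: \<theta> powr_divide powr_diff field_simps)
    also have "\<dots> \<le> w i powr (1 - 1 / p)"
      using l(2)[OF i] \<beta>_pos[OF i] d p by (intro powr_mono2) (auto simp: w_def field_simps)
    also have "\<dots> = \<theta> ^ l i"
      using d by (simp add: w_def \<theta> powr_realpow[symmetric] powr_powr powr_divide powr_minus_divide[symmetric] algebra_simps)
    finally have 1: "\<theta> * \<beta> i powr (1 - 1 / p) \<le> \<theta> ^ l i" .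
    \<comment> \<open>In this form of \<open>b i\<close> the exponents \<open>1 / p\<close> and
      \<open>1 - 1 / p\<close> of \<open>\<beta> i\<close> combine to the full share, and the shares
      add up to \<open>1\<close>.\<close>
    have "b i powr p = S * \<beta> i" using S by (simp add: \<beta>_def)
    then have "(b i powr p) powr (1 / p) = S powr (1 / p) * \<beta> i powr (1 / p)"
      using S \<beta>_pos[OF i] by (simp add: powr_mult)
    then have 2: "b i = S powr (1 / p) * \<beta> i powr (1 / p)" using b[OF i] p by (simp add: powr_powr)
    have "\<beta> i powr (1 - 1 / p) * \<beta> i powr (1 / p) = \<beta> i"
      using \<beta>_pos[OF i] by (simp flip: powr_add)
    then have "\<theta>\<^sup>2 * S powr (1 / p) * \<beta> i = \<theta> * (\<theta> * \<beta> i powr (1 - 1 / p)) * b i"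
      unfolding 2 by (simp add: power2_eq_square mult_ac)
    also have "\<dots> \<le> \<theta> * \<theta> ^ l i * b i"
      using 1 \<theta>_pos b[OF i] by (intro mult_right_mono mult_left_mono) auto
    finally show ?thesis by simp
  qed
  then have "(\<Sum>i\<in>J. \<theta>\<^sup>2 * S powr (1 / p) * \<beta> i) \<le> (\<Sum>i\<in>J. \<theta> ^ (l i + 1) * b i)"
    by (rule sum_mono)
  then have "\<theta>\<^sup>2 * S powr (1 / p) \<le> (\<Sum>i\<in>J. \<theta> ^ (l i + 1) * b i)"
    by (simp add: \<beta>_sum flip: sum_distrib_left)
  ultimately show ?thesis by (simp add: S_def)
qed

section \<open>Mass distributions on norming functionals\<close>

definition final_part :: "nat list set \<Rightarrow> nat list set \<Rightarrow> bool" where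
  "final_part B I \<longleftrightarrow> I \<subseteq> B \<and> (\<forall>u\<in>I. \<forall>v\<in>B. u \<prec> v \<longrightarrow> v \<in> I)"

definition initial_part :: "nat list set \<Rightarrow> nat list set \<Rightarrow> bool" where
  "initial_part B I \<longleftrightarrow> I \<subseteq> B \<and> (\<forall>u\<in>I. \<forall>v\<in>B. v \<prec> u \<longrightarrow> v \<in> I)"

definition convex_part :: "nat list set \<Rightarrow> nat list set \<Rightarrow> bool" where
  "convex_part B I \<longleftrightarrow> I \<subseteq> B \<and> (\<forall>u\<in>I. \<forall>w\<in>I. \<forall>v\<in>B. u \<prec> v \<longrightarrow> v \<prec> w \<longrightarrow> v \<in> I)"

text \<open>Serves both functionals and, with \<open>y\<close> constantly \<open>1\<close>,
  masses.\<close>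

lemma sum_restr_family:
  fixes y :: "'a \<Rightarrow> real"
  assumes "finite I"
  shows "(\<Sum>v\<in>I. (\<Sum>i\<in>R. restr (B i) (\<phi> i) v) * y v) = (\<Sum>i\<in>R. \<Sum>v\<in>I \<inter> B i. \<phi> i v * y v)"
proof -
  have "(\<Sum>v\<in>I. (\<Sum>i\<in>R. restr (B i) (\<phi> i) v) * y v) = (\<Sum>i\<in>R. \<Sum>v\<in>I. restr (B i) (\<phi> i) v * y v)"
    by (simp add: sum_distrib_right sum.swap[of _ R])
  also have "\<dots> = (\<Sum>i\<in>R. \<Sum>v\<in>I \<inter> B i. \<phi> i v * y v)"
    by (rule sum.cong[OF refl], subst sum.inter_restrict[OF assms], rule sum.cong[OF refl])
      (simp add: restr_def)
  finally show ?thesis .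
qed

context T_space
begin

text \<open>The leaves of the tree of a norming functional \<open>f\<close> carry a probability weight \<open>\<mu>\<close>, divided
  evenly among the children of each node.\<close>

definition norming :: "real \<Rightarrow> nat list set \<Rightarrow> (nat list \<Rightarrow> real) \<Rightarrow> (nat list \<Rightarrow> real) \<Rightarrow> bool" where
  "norming \<kappa> B f \<mu> \<longleftrightarrow>
     finite B \<and> (\<forall>v\<in>B. 0 \<le> \<mu> v) \<and> sum \<mu> B = 1 \<and>
     (\<forall>y\<in>c00 k. \<forall>I. I \<subseteq> B \<longrightarrow> \<bar>\<Sum>v\<in>I. f v * y v\<bar> \<le> N y) \<and>
     (\<forall>y\<in>c00 k. \<forall>I. final_part B I \<or> initial_part B I \<longrightarrow>
        \<bar>\<Sum>v\<in>I. f v * y v\<bar> \<le> 1 / \<theta> * sum \<mu> I powr \<kappa> * N y) \<and>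
     (\<forall>y\<in>c00 k. \<forall>I. convex_part B I \<longrightarrow>
        \<bar>\<Sum>v\<in>I. f v * y v\<bar> \<le> 2 / \<theta> * sum \<mu> I powr \<kappa> * N y)"

lemma norming_le:
  "norming \<kappa> B f \<mu> \<Longrightarrow> y \<in> c00 k \<Longrightarrow> I \<subseteq> B \<Longrightarrow> \<bar>\<Sum>v\<in>I. f v * y v\<bar> \<le> N y"
  by (simp add: norming_def)

lemma norming_ray_le:
  "norming \<kappa> B f \<mu> \<Longrightarrow> y \<in> c00 k \<Longrightarrow> final_part B I \<or> initial_part B I \<Longrightarrow>
     \<bar>\<Sum>v\<in>I. f v * y v\<bar> \<le> 1 / \<theta> * sum \<mu> I powr \<kappa> * N y"
  unfolding norming_def by blast

lemma norming_convex_le: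
  "norming \<kappa> B f \<mu> \<Longrightarrow> y \<in> c00 k \<Longrightarrow> convex_part B I \<Longrightarrow>
     \<bar>\<Sum>v\<in>I. f v * y v\<bar> \<le> 2 / \<theta> * sum \<mu> I powr \<kappa> * N y"
  unfolding norming_def by blast

text \<open>Everything depends on the set \<open>J I\<close> of children met by a part
  \<open>I\<close>: \<open>full\<close> settles a part that contains a whole child, and otherwise
  \<open>pieces\<close> charges one constant for each child met.\<close>

lemma norming_combine:
  fixes R :: "nat set"
  assumes \<kappa>: "0 \<le> \<kappa>" and \<theta>: "\<theta> = real d powr (- \<kappa>)"
    and R: "finite R" "R \<noteq> {}" "card R \<le> d"
    and AR: "\<And>i. i \<in> R \<Longrightarrow> E i \<in> AR k"
    and less: "\<And>i j. i \<in> R \<Longrightarrow> j \<in> R \<Longrightarrow> i < j \<Longrightarrow> set_less (E i) (E j)"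
    and BE: "\<And>i. i \<in> R \<Longrightarrow> B i \<subseteq> E i"
    and norming: "\<And>i. i \<in> R \<Longrightarrow> norming \<kappa> (B i) (f i) (\<mu> i)"
  shows "norming \<kappa> (\<Union>i\<in>R. B i)
     (\<lambda>v. \<theta> * (\<Sum>i\<in>R. restr (B i) (f i) v)) (\<lambda>v. (\<Sum>i\<in>R. restr (B i) (\<mu> i) v) / card R)"
proof -
  define A where "A = (\<Union>i\<in>R. B i)"
  define F where "F v = \<theta> * (\<Sum>i\<in>R. restr (B i) (f i) v)" for v
  define \<nu> where "\<nu> v = (\<Sum>i\<in>R. restr (B i) (\<mu> i) v) / card R" for v
  define J where "J I = {i \<in> R. I \<inter> B i \<noteq> {}}" for I
  have card_pos: "0 < real (card R)" using R by (simp add: card_gt_0_iff)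
  have finA: "finite A" using R norming by (auto simp: A_def norming_def)
  have BA: "B i \<subseteq> A" if "i \<in> R" for i using that by (auto simp: A_def)
  have B_less: "u \<prec> w" if "i \<in> R" "j \<in> R" "i < j" "u \<in> B i" "w \<in> B j" for i j u w
    using less[OF that(1-3)] BE[OF that(1)] BE[OF that(2)] that(4,5) by (auto simp: set_less_def)
  have \<mu>_nonneg: "0 \<le> \<mu> i v" if "i \<in> R" "v \<in> B i" for i v
    using norming[OF that(1)] that(2) by (simp add: norming_def)
  have F_sum: "(\<Sum>v\<in>I. F v * y v) = \<theta> * (\<Sum>i\<in>R. \<Sum>v\<in>I \<inter> B i. f i v * y v)" if "I \<subseteq> A" for I y
  proof -
    have "finite I" using that finA finite_subset by blast
    have "(\<Sum>v\<in>I. F v * y v) = \<theta> * (\<Sum>v\<in>I. (\<Sum>i\<in>R. restr (B i) (f i) v) * y v)"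
      by (subst sum_distrib_left) (simp add: F_def mult.assoc)
    then show ?thesis unfolding sum_restr_family[OF \<open>finite I\<close>] .
  qed
  have \<nu>_sum: "sum \<nu> I = (\<Sum>i\<in>R. sum (\<mu> i) (I \<inter> B i)) / card R" if "I \<subseteq> A" for I
    using sum_restr_family[of I B \<mu> R "\<lambda>_. 1"] that finA finite_subset[of I A]
    by (simp add: \<nu>_def sum_divide_distrib[symmetric])
  have part_nonneg: "0 \<le> sum (\<mu> i) (I \<inter> B i)" if "i \<in> R" for i I
    using \<mu>_nonneg that by (intro sum_nonneg) auto
  have part_le: "sum (\<mu> i) (I \<inter> B i) / card R \<le> sum \<nu> I" if "i \<in> R" "I \<subseteq> A" for i I
    unfolding \<nu>_sum[OF that(2)] using part_nonneg that(1) R(1)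
    by (intro divide_right_mono member_le_sum) auto
  \<comment> \<open>For \<open>d\<close> children this would be an equality; dividing the mass among
    fewer children only makes the right-hand side larger.\<close>
  have \<theta>_card: "\<theta> * t powr \<kappa> \<le> (t / card R) powr \<kappa>" if "0 \<le> t" for t
  proof -
    have "\<theta> * t powr \<kappa> = (t / d) powr \<kappa>" using that by (simp add: \<theta> powr_divide powr_minus_divide)
    also have "\<dots> \<le> (t / card R) powr \<kappa>"
      using that R card_pos \<kappa> by (intro powr_mono2 divide_left_mono) auto
    finally show ?thesis .
  qed
  have term_le: "\<theta> * sum (\<mu> i) (I \<inter> B i) powr \<kappa> \<le> sum \<nu> I powr \<kappa>" if "i \<in> R" "I \<subseteq> A" for i I
  proof -
    have "(sum (\<mu> i) (I \<inter> B i) / card R) powr \<kappa> \<le> sum \<nu> I powr \<kappa>"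
      using part_le[OF that] part_nonneg[OF that(1)] \<kappa> by (intro powr_mono2) auto
    then show ?thesis using \<theta>_card[OF part_nonneg[OF that(1)]] order_trans by blast
  qed
  have any: "\<bar>\<Sum>v\<in>I. F v * y v\<bar> \<le> N y" if y: "y \<in> c00 k" and I: "I \<subseteq> A" for y I
  proof -
    have "\<bar>\<Sum>v\<in>I. F v * y v\<bar> \<le> \<theta> * (\<Sum>i\<in>R. \<bar>\<Sum>v\<in>I \<inter> B i. f i v * y v\<bar>)"
      unfolding F_sum[OF I] abs_mult abs_of_pos[OF \<theta>_pos]
      by (intro mult_left_mono sum_abs) (use \<theta>_pos in simp)
    also have "\<dots> \<le> \<theta> * (\<Sum>i\<in>R. N (restr (E i) y))"
    proof (intro mult_left_mono sum_mono)
      fix i assume i: "i \<in> R"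
      \<comment> \<open>The leaves of child \<open>i\<close> lie in \<open>E i\<close>, so
        \<open>y\<close> may be cut down to \<open>E i\<close>; the admissible family then
        recombines these norms into \<open>N y\<close>.\<close>
      have eq: "(\<Sum>v\<in>I \<inter> B i. f i v * y v) = (\<Sum>v\<in>I \<inter> B i. f i v * restr (E i) y v)"
        using BE[OF i] by (intro sum.cong) (auto simp: restr_def)
      show "\<bar>\<Sum>v\<in>I \<inter> B i. f i v * y v\<bar> \<le> N (restr (E i) y)"
        unfolding eq by (rule norming_le[OF norming[OF i] restr_c00[OF y]]) simp
    qed (use \<theta>_pos in simp)
    also have "\<dots> \<le> N y" using indexed_admissible_le_N[OF y R(1,3) AR less] .
    finally show ?thesis .
  qed
  have full: "\<bar>\<Sum>v\<in>I. F v * y v\<bar> \<le> 1 / \<theta> * sum \<nu> I powr \<kappa> * N y"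
    if y: "y \<in> c00 k" and I: "I \<subseteq> A" and i: "i \<in> R" "B i \<subseteq> I" for y I i
  proof -
    \<comment> \<open>A whole child has mass \<open>1\<close> before the division, so
      \<open>term_le\<close> reads \<open>\<theta> \<le> sum \<nu> I powr \<kappa>\<close>, and the
      bound follows from \<open>any\<close>.\<close>
    have "I \<inter> B i = B i" using i by blast
    then have "\<theta> \<le> sum \<nu> I powr \<kappa>"
      using term_le[OF i(1) I] norming[OF i(1)] by (simp add: norming_def)
    then have "1 * N y \<le> 1 / \<theta> * sum \<nu> I powr \<kappa> * N y"
      using \<theta>_pos N_nonneg[OF y] by (intro mult_right_mono) (simp_all add: pos_le_divide_eq)
    then show ?thesis using any[OF y I] by simp
  qed
  have pieces: "\<bar>\<Sum>v\<in>I. F v * y v\<bar> \<le> card (J I) * (C * sum \<nu> I powr \<kappa> * N y)"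
    if y: "y \<in> c00 k" and I: "I \<subseteq> A" and C: "0 \<le> C"
      and le: "\<And>i. i \<in> J I \<Longrightarrow>
        \<bar>\<Sum>v\<in>I \<inter> B i. f i v * y v\<bar> \<le> C * sum (\<mu> i) (I \<inter> B i) powr \<kappa> * N y" for y I C
  proof -
    have "(\<Sum>i\<in>R. \<Sum>v\<in>I \<inter> B i. f i v * y v) = (\<Sum>i\<in>J I. \<Sum>v\<in>I \<inter> B i. f i v * y v)"
      using R by (intro sum.mono_neutral_right) (auto simp: J_def)
    then have "\<bar>\<Sum>v\<in>I. F v * y v\<bar> \<le> (\<Sum>i\<in>J I. \<theta> * \<bar>\<Sum>v\<in>I \<inter> B i. f i v * y v\<bar>)"
      unfolding F_sum[OF I] abs_mult abs_of_pos[OF \<theta>_pos] sum_distrib_left[symmetric]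
      by simp (intro mult_left_mono sum_abs, use \<theta>_pos in simp)
    also have "\<dots> \<le> (\<Sum>i\<in>J I. C * sum \<nu> I powr \<kappa> * N y)"
    proof (rule sum_mono)
      fix i assume i: "i \<in> J I"
      have "\<theta> * \<bar>\<Sum>v\<in>I \<inter> B i. f i v * y v\<bar> \<le> \<theta> * (C * sum (\<mu> i) (I \<inter> B i) powr \<kappa> * N y)"
        using le[OF i] \<theta>_pos by simp
      also have "\<dots> = C * (\<theta> * sum (\<mu> i) (I \<inter> B i) powr \<kappa>) * N y" by simp
      also have "\<dots> \<le> C * sum \<nu> I powr \<kappa> * N y"
        using term_le[of i I] i I C N_nonneg[OF y]
        by (intro mult_right_mono mult_left_mono) (auto simp: J_def)
      finally show "\<theta> * \<bar>\<Sum>v\<in>I \<inter> B i. f i v * y v\<bar> \<le> C * sum \<nu> I powr \<kappa> * N y" .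
    qed
    finally show ?thesis by simp
  qed
  have finJ: "finite (J I)" for I using R by (simp add: J_def)
  have ray: "\<bar>\<Sum>v\<in>I. F v * y v\<bar> \<le> 1 / \<theta> * sum \<nu> I powr \<kappa> * N y"
    if y: "y \<in> c00 k" and ray: "final_part A I \<or> initial_part A I" for y I
  proof (cases "\<exists>i\<in>R. B i \<subseteq> I")
    case True
    then show ?thesis using full[OF y] ray by (auto simp: final_part_def initial_part_def)
  next
    case False
    have I: "I \<subseteq> A" using ray by (auto simp: final_part_def initial_part_def)
    \<comment> \<open>A final part that meets two children contains the whole later one, an initial
      part the whole earlier one; this case excludes both.\<close>
    have "i = j" if ij: "i \<in> J I" "j \<in> J I" "i \<le> j" for i j
    proof (rule ccontr)
      assume "i \<noteq> j"
      then have "i < j" using ij by simp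
      obtain u w where u: "u \<in> I" "u \<in> B i" and w: "w \<in> I" "w \<in> B j"
        using ij by (auto simp: J_def)
      have R: "i \<in> R" "j \<in> R" using ij by (auto simp: J_def)
      from ray have "B i \<subseteq> I \<or> B j \<subseteq> I"
      proof
        assume fin: "final_part A I"
        have "v \<in> I" if v: "v \<in> B j" for v
          using fin B_less[OF R \<open>i < j\<close> u(2) v] u(1) BA[OF R(2)] v by (auto simp: final_part_def)
        then show ?thesis by blast
      next
        assume ini: "initial_part A I"
        have "v \<in> I" if v: "v \<in> B i" for v
          using ini B_less[OF R \<open>i < j\<close> v w(2)] w(1) BA[OF R(1)] v by (auto simp: initial_part_def)
        then show ?thesis by blast
      qed
      then show False using False ij by (auto simp: J_def)
    qed
    then have "i = j" if "i \<in> J I" "j \<in> J I" for i j using that nle_le[of i j] by blast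
    then have "card (J I) \<le> 1" using finJ[of I] card_le_Suc0_iff_eq[of "J I"] by simp
    moreover have "\<bar>\<Sum>v\<in>I. F v * y v\<bar> \<le> card (J I) * (1 / \<theta> * sum \<nu> I powr \<kappa> * N y)"
    proof (rule pieces[OF y I])
      fix i assume i: "i \<in> J I"
      then have "final_part (B i) (I \<inter> B i) \<or> initial_part (B i) (I \<inter> B i)"
        using ray BA[of i] by (auto simp: J_def final_part_def initial_part_def)
      then show "\<bar>\<Sum>v\<in>I \<inter> B i. f i v * y v\<bar> \<le> 1 / \<theta> * sum (\<mu> i) (I \<inter> B i) powr \<kappa> * N y"
        using norming_ray_le[OF norming[of i] y] i by (simp add: J_def)
    qed (use \<theta>_pos in simp)
    moreover have "0 \<le> 1 / \<theta> * sum \<nu> I powr \<kappa> * N y" using \<theta>_pos N_nonneg[OF y] by simp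
    ultimately show ?thesis
      using mult_right_mono[of "real (card (J I))" 1 "1 / \<theta> * sum \<nu> I powr \<kappa> * N y"] by linarith
  qed
  have conv: "\<bar>\<Sum>v\<in>I. F v * y v\<bar> \<le> 2 / \<theta> * sum \<nu> I powr \<kappa> * N y"
    if y: "y \<in> c00 k" and conv: "convex_part A I" for y I
  proof -
    have I: "I \<subseteq> A" using conv by (auto simp: convex_part_def)
    have convD: "v \<in> I" if "u \<in> I" "w \<in> I" "v \<in> A" "u \<prec> v" "v \<prec> w" for u w v
      using conv that unfolding convex_part_def by blast
    have nn: "0 \<le> 1 / \<theta> * sum \<nu> I powr \<kappa> * N y" using \<theta>_pos N_nonneg[OF y] by simp
    consider (whole) i where "i \<in> R" "B i \<subseteq> I" | (none) "\<And>i. i \<in> R \<Longrightarrow> \<not> B i \<subseteq> I" "J I = {}"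
      | (one) "\<And>i. i \<in> R \<Longrightarrow> \<not> B i \<subseteq> I" "J I \<noteq> {}" "Min (J I) = Max (J I)"
      | (two) "\<And>i. i \<in> R \<Longrightarrow> \<not> B i \<subseteq> I" "J I \<noteq> {}" "Min (J I) < Max (J I)"
    proof -
      have "J I = {} \<or> Min (J I) = Max (J I) \<or> Min (J I) < Max (J I)"
        using Max_ge[OF finJ Min_in[OF finJ], of I] by linarith
      then show thesis using that by blast
    qed
    then show ?thesis
    proof cases
      case whole
      then show ?thesis using full[OF y I, of i] nn by simp
    next
      case none
      \<comment> \<open>\<open>order_refl\<close> sets the constant \<open>C\<close> of
        \<open>pieces\<close> to \<open>0\<close>; the bounds on the children are vacuous because
        \<open>J I\<close> is empty.\<close>
      then show ?thesis using pieces[OF y I order_refl] nn by simp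
    next
      case one
      have "J I = {Max (J I)}"
      proof (intro equalityI subsetI)
        fix i assume "i \<in> J I"
        then have "Min (J I) \<le> i" "i \<le> Max (J I)" using finJ[of I] by simp_all
        then show "i \<in> {Max (J I)}" using one(3) by simp
      qed (use Max_in[OF finJ one(2)] in simp)
      then have "card (J I) = card {Max (J I)}" by (rule arg_cong)
      then have card: "card (J I) = 1" by simp
      have "\<bar>\<Sum>v\<in>I. F v * y v\<bar> \<le> card (J I) * (2 / \<theta> * sum \<nu> I powr \<kappa> * N y)"
      proof (rule pieces[OF y I])
        fix i assume i: "i \<in> J I"
        then have "B i \<subseteq> A" using BA by (simp add: J_def)
        have "convex_part (B i) (I \<inter> B i)"
          unfolding convex_part_def
        proof (intro conjI ballI impI)
          fix u w v assume uwv: "u \<in> I \<inter> B i" "w \<in> I \<inter> B i" "v \<in> B i" "u \<prec> v" "v \<prec> w"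
          then have "v \<in> A" using \<open>B i \<subseteq> A\<close> by blast
          then show "v \<in> I \<inter> B i" using convD[of u w v] uwv by simp
        qed simp
        then show "\<bar>\<Sum>v\<in>I \<inter> B i. f i v * y v\<bar> \<le> 2 / \<theta> * sum (\<mu> i) (I \<inter> B i) powr \<kappa> * N y"
          using norming_convex_le[OF norming[of i] y] i by (simp add: J_def)
      qed (use \<theta>_pos in simp)
      then show ?thesis by (simp add: card)
    next
      case two
      define i0 i1 where "i0 = Min (J I)" and "i1 = Max (J I)"
      have i0: "i0 \<in> J I" and i1: "i1 \<in> J I" and "i0 < i1"
        using two finJ[of I] by (auto simp: i0_def i1_def)
      obtain u w where u: "u \<in> I" "u \<in> B i0" and w: "w \<in> I" "w \<in> B i1"
        using i0 i1 by (auto simp: J_def)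
      \<comment> \<open>A child strictly between the outermost two lies between \<open>u\<close> and
        \<open>w\<close>, so convexity would put all of it into \<open>I\<close>.\<close>
      have two_pieces: "i = i0 \<or> i = i1" if i: "i \<in> J I" for i
      proof (rule ccontr)
        assume "\<not> (i = i0 \<or> i = i1)"
        moreover have "i0 \<le> i" "i \<le> i1" using i finJ[of I] by (simp_all add: i0_def i1_def)
        ultimately have "i0 < i" "i < i1" by simp_all
        then have "u \<prec> v \<and> v \<prec> w" if "v \<in> B i" for v
          using B_less[of i0 i u v] B_less[of i i1 v w] u w i i0 i1 that by (simp add: J_def)
        moreover have "v \<in> A" if "v \<in> B i" for v using BA[of i] i that by (auto simp: J_def)
        ultimately have "v \<in> I" if "v \<in> B i" for v
          using convD[OF u(1) w(1)] that by blast
        then have "B i \<subseteq> I" by blast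
        then show False using two(1)[of i] i by (simp add: J_def)
      qed
      then have "J I = {i0, i1}" using i0 i1 by blast
      then have card: "card (J I) = 2" using \<open>i0 < i1\<close> by simp
      have "\<bar>\<Sum>v\<in>I. F v * y v\<bar> \<le> card (J I) * (1 / \<theta> * sum \<nu> I powr \<kappa> * N y)"
      proof (rule pieces[OF y I])
        fix i assume i: "i \<in> J I"
        \<comment> \<open>All of \<open>B i0\<close> precedes \<open>w\<close>, so convexity keeps
          in \<open>I\<close> whatever follows a point of \<open>I\<close> there; the point
          \<open>u\<close> does the same for \<open>B i1\<close> from the other side.\<close>
        have "final_part (B i0) (I \<inter> B i0)"
          unfolding final_part_def
        proof (intro conjI ballI impI)
          fix u' v assume "u' \<in> I \<inter> B i0" "v \<in> B i0" "u' \<prec> v"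
          moreover have "v \<prec> w" using B_less[of i0 i1 v w] i0 i1 \<open>i0 < i1\<close> w \<open>v \<in> B i0\<close> by (simp add: J_def)
          moreover have "v \<in> A" using BA[of i0] i0 \<open>v \<in> B i0\<close> by (auto simp: J_def)
          ultimately show "v \<in> I \<inter> B i0" using convD[of u' w v] w by blast
        qed simp
        moreover have "initial_part (B i1) (I \<inter> B i1)"
          unfolding initial_part_def
        proof (intro conjI ballI impI)
          fix w' v assume "w' \<in> I \<inter> B i1" "v \<in> B i1" "v \<prec> w'"
          moreover have "u \<prec> v" using B_less[of i0 i1 u v] i0 i1 \<open>i0 < i1\<close> u \<open>v \<in> B i1\<close> by (simp add: J_def)
          moreover have "v \<in> A" using BA[of i1] i1 \<open>v \<in> B i1\<close> by (auto simp: J_def)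
          ultimately show "v \<in> I \<inter> B i1" using convD[of u w' v] u by blast
        qed simp
        ultimately have "final_part (B i) (I \<inter> B i) \<or> initial_part (B i) (I \<inter> B i)"
          using two_pieces[OF i] by blast
        then show "\<bar>\<Sum>v\<in>I \<inter> B i. f i v * y v\<bar> \<le> 1 / \<theta> * sum (\<mu> i) (I \<inter> B i) powr \<kappa> * N y"
          using norming_ray_le[OF norming[of i] y] i by (simp add: J_def)
      qed (use \<theta>_pos in simp)
      then show ?thesis by (simp add: card)
    qed
  qed
  have \<nu>_nonneg: "\<forall>v\<in>A. 0 \<le> \<nu> v"
  proof
    fix v
    have "0 \<le> restr (B i) (\<mu> i) v" if "i \<in> R" for i using \<mu>_nonneg[OF that] by (simp add: restr_def)
    then show "0 \<le> \<nu> v" by (simp add: \<nu>_def sum_nonneg)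
  qed
  have "sum \<nu> A = (\<Sum>i\<in>R. sum (\<mu> i) (B i)) / card R"
    using BA by (simp add: \<nu>_sum Int_absorb1)
  also have "\<dots> = 1" using norming card_pos by (simp add: norming_def)
  finally have "norming \<kappa> A F \<nu>"
    unfolding norming_def
    by (intro conjI ballI allI impI finA \<nu>_nonneg[rule_format] any ray conv) assumption+
  then show ?thesis by (simp add: A_def F_def[abs_def] \<nu>_def[abs_def])
qed

lemma norming_single:
  assumes \<kappa>: "0 < \<kappa>" and s: "\<bar>s\<bar> \<le> 1"
  shows "norming \<kappa> {v} (\<lambda>_. s) (\<lambda>_. 1)"
proof -
  have 1: "\<bar>\<Sum>v\<in>I. s * y v\<bar> \<le> N y" if "y \<in> c00 k" "I \<subseteq> {v}" for y I
  proof -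
    have "\<bar>s * y v\<bar> \<le> 1 * \<bar>y v\<bar>" using s unfolding abs_mult by (intro mult_right_mono) auto
    then have "\<bar>s * y v\<bar> \<le> N y" using abs_le_N[OF that(1), of v] by linarith
    moreover have "I = {} \<or> I = {v}" using that by auto
    ultimately show ?thesis using N_nonneg[OF that(1)] by auto
  qed
  \<comment> \<open>Gives the bound for end pieces with \<open>C = 1\<close> and the one for convex
    parts with \<open>C = 2\<close>.\<close>
  have 2: "\<bar>\<Sum>v\<in>I. s * y v\<bar> \<le> C / \<theta> * (\<Sum>v\<in>I. 1) powr \<kappa> * N y"
    if "y \<in> c00 k" "I \<subseteq> {v}" "1 \<le> C" for y I and C :: real
  proof (cases "I = {}")
    case False
    then have I: "I = {v}" using that by auto
    have "1 \<le> C / \<theta>" using that \<theta>_pos \<theta>_less by (simp add: pos_le_divide_eq)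
    then have "1 * N y \<le> C / \<theta> * N y" using N_nonneg[OF that(1)] by (intro mult_right_mono) auto
    then show ?thesis using 1[OF that(1,2)] I by simp
  qed simp
  show ?thesis
    unfolding norming_def using 1 2[of _ _ 1] 2[of _ _ 2]
    by (simp add: final_part_def initial_part_def convex_part_def)
qed

text \<open>The recursion of the levels is unfolded into a tree, ending in signs at single points.
  The total mass \<open>1\<close> has to sit on \<open>supp z\<close>: hence the nonempty support,
  and in the induction step the removal of those \<open>E i\<close> that miss it.\<close>

lemma level_norming_functional:
  assumes \<kappa>: "0 < \<kappa>" and \<theta>: "\<theta> = real d powr (- \<kappa>)"
    and "z \<in> c00 k" and "supp z \<noteq> {}"
  shows "\<exists>B f \<mu>. B \<subseteq> supp z \<and> norming \<kappa> B f \<mu> \<and> level j z \<le> (\<Sum>v\<in>B. f v * z v)"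
  using assms(3,4)
proof (induction j arbitrary: z)
  case 0
  obtain v where v: "level 0 z = \<bar>z v\<bar>" using level_0_attained[OF 0(1)] by blast
  obtain u where "u \<in> supp z" using 0(2) by blast
  then have "z v \<noteq> 0" using abs_le_level_0[OF 0(1), of u] v by (auto simp: supp_def)
  then have "{v} \<subseteq> supp z" by (simp add: supp_def)
  moreover have "norming \<kappa> {v} (\<lambda>_. sgn (z v)) (\<lambda>_. 1)" by (rule norming_single[OF \<kappa>]) (simp add: abs_sgn_eq)
  moreover have "level 0 z \<le> (\<Sum>v'\<in>{v}. sgn (z v) * z v')" using v by (simp add: abs_sgn mult.commute)
  ultimately show ?case by blast
next
  case (Suc j)
  show ?case
  proof (cases rule: level_Suc_cases[OF Suc.prems(1), of j, case_names same sum])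
    case same
    then show ?thesis using Suc.IH[OF Suc.prems] by simp
  next
    case (sum m E)
    define R where "R = {i \<in> {..<m}. supp (restr (E i) z) \<noteq> {}}"
    have "level j (restr (E i) z) = 0" if "supp (restr (E i) z) = {}" for i
      using level_le_l1[OF restr_c00[OF Suc.prems(1)], of j "E i"]
        level_nonneg[OF restr_c00[OF Suc.prems(1)], of j "E i"] that by simp
    then have sum_R: "level (Suc j) z = \<theta> * (\<Sum>i\<in>R. level j (restr (E i) z))"
      unfolding sum(3) R_def by (intro arg_cong[where f = "times \<theta>"] sum.mono_neutral_right) auto
    show ?thesis
    proof (cases "R = {}")
      case True
      \<comment> \<open>All pieces vanish, so the new level is \<open>0\<close> and the functional
        of the previous level serves.\<close>
      then have "level (Suc j) z \<le> level j z"
        unfolding sum_R using level_nonneg[OF Suc.prems(1), of j] by simp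
      then show ?thesis using Suc.IH[OF Suc.prems] order_trans by blast
    next
      case False
      have "\<forall>i\<in>R. \<exists>B f \<mu>. B \<subseteq> supp (restr (E i) z) \<and> norming \<kappa> B f \<mu> \<and>
          level j (restr (E i) z) \<le> (\<Sum>v\<in>B. f v * restr (E i) z v)"
        by (intro ballI Suc.IH restr_c00 Suc.prems) (simp add: R_def)
      from bchoice[OF this] obtain B where "\<forall>i\<in>R. \<exists>f \<mu>. B i \<subseteq> supp (restr (E i) z) \<and>
          norming \<kappa> (B i) f \<mu> \<and> level j (restr (E i) z) \<le> (\<Sum>v\<in>B i. f v * restr (E i) z v)"
        by blast
      from bchoice[OF this] obtain f where "\<forall>i\<in>R. \<exists>\<mu>. B i \<subseteq> supp (restr (E i) z) \<and>
          norming \<kappa> (B i) (f i) \<mu> \<and> level j (restr (E i) z) \<le> (\<Sum>v\<in>B i. f i v * restr (E i) z v)"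
        by blast
      from bchoice[OF this] obtain \<mu> where B: "\<And>i. i \<in> R \<Longrightarrow> B i \<subseteq> supp (restr (E i) z)"
        and norming: "\<And>i. i \<in> R \<Longrightarrow> norming \<kappa> (B i) (f i) (\<mu> i)"
        and le: "\<And>i. i \<in> R \<Longrightarrow> level j (restr (E i) z) \<le> (\<Sum>v\<in>B i. f i v * restr (E i) z v)"
        by blast
      have finR: "finite R" by (simp add: R_def)
      have "card R \<le> card {..<m}" by (intro card_mono) (auto simp: R_def)
      then have card: "card R \<le> d" using sum(2) by (simp add: admissible_def)
      have comb: "norming \<kappa> (\<Union>i\<in>R. B i) (\<lambda>v. \<theta> * (\<Sum>i\<in>R. restr (B i) (f i) v))
          (\<lambda>v. (\<Sum>i\<in>R. restr (B i) (\<mu> i) v) / card R)"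
      proof (rule norming_combine[OF _ \<theta> finR False card])
        show "E i \<in> AR k" if "i \<in> R" for i using that sum(2) by (simp add: R_def admissible_def)
        show "set_less (E i) (E j)" if "i \<in> R" "j \<in> R" "i < j" for i j
          using that admissible_set_less[OF sum(2), of i j] by (simp add: R_def)
        show "B i \<subseteq> E i" if "i \<in> R" for i using B[OF that] by (auto simp: supp_restr)
      qed (use \<kappa> norming in auto)
      have fin_Un: "finite (\<Union>i\<in>R. B i)" using comb unfolding norming_def by (rule conjunct1)
      have "level (Suc j) z \<le> \<theta> * (\<Sum>i\<in>R. \<Sum>v\<in>B i. f i v * restr (E i) z v)"
        unfolding sum_R using le \<theta>_pos by (intro mult_left_mono sum_mono) auto
      also have "\<dots> = \<theta> * (\<Sum>i\<in>R. \<Sum>v\<in>(\<Union>i\<in>R. B i) \<inter> B i. f i v * z v)"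
      proof (rule arg_cong[where f = "times \<theta>"], rule sum.cong[OF refl], rule sum.cong)
        fix i v assume i: "i \<in> R" and "v \<in> (\<Union>i\<in>R. B i) \<inter> B i"
        then have "v \<in> E i" using B[OF i] by (auto simp: supp_restr)
        then show "f i v * restr (E i) z v = f i v * z v" by (simp add: restr_def)
      qed blast
      also have "\<dots> = (\<Sum>v\<in>(\<Union>i\<in>R. B i). \<theta> * (\<Sum>i\<in>R. restr (B i) (f i) v) * z v)"
        unfolding sum_restr_family[OF fin_Un, symmetric]
        by (subst sum_distrib_left) (simp only: mult.assoc)
      finally have "level (Suc j) z \<le> (\<Sum>v\<in>(\<Union>i\<in>R. B i). \<theta> * (\<Sum>i\<in>R. restr (B i) (f i) v) * z v)" .
      moreover have "(\<Union>i\<in>R. B i) \<subseteq> supp z" using B by (auto simp: supp_restr)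
      ultimately show ?thesis using comb by (intro exI conjI)
    qed
  qed
qed

end

section \<open>Block sequences along the sets \<open>X_max\<close>\<close>

locale X_max_blocks = T_space +
  fixes x :: "nat \<Rightarrow> nat list \<Rightarrow> real" and v :: "nat \<Rightarrow> nat list"
  assumes x_c00: "x i \<in> c00 k" and x_nonzero: "supp (x i) \<noteq> {}" and N_x: "N (x i) = 1"
    and v_nd: "v i \<in> nd k"
    and v_le: "set_le {v i} (supp (x i))"
    and v_greater: "set_less (supp (x i)) {v (Suc i)}"
    and supp_X_max: "supp (x i) \<subseteq> X_max k (v i)"
    and v_Suc: "v (Suc i) \<in> X_max k (v i)"
begin

lemma v_less: "i < j \<Longrightarrow> v i \<prec> v j"
proof (induction j)
  case (Suc j)
  obtain u where "u \<in> supp (x j)" using x_nonzero by blast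
  then have "v j = u \<or> v j \<prec> u" "u \<prec> v (Suc j)"
    using v_le[of j] v_greater[of j] by (auto simp: set_le_def set_less_def)
  then have "v j \<prec> v (Suc j)" using prec_trans[of "v j" u] by auto
  then show ?case using Suc prec_trans[of "v i" "v j"] by (cases "i = j") auto
qed simp

lemma v_in_X_max: "i \<le> j \<Longrightarrow> v j \<in> X_max k (v i)"
proof (induction j rule: dec_induct)
  case base
  show ?case by (rule self_in_X_max[OF v_nd])
next
  case (step j)
  then show ?case using X_max_mono[OF v_nd k, of "v j" i] v_Suc[of j] by blast
qed

lemma supp_less_v:
  assumes "u \<in> supp (x i)" "i < j"
  shows "u \<prec> v j"
proof -
  have "u \<prec> v (Suc i)" using v_greater[of i] assms by (simp add: set_less_def)
  then show ?thesis
    using assms v_less[of "Suc i" j] prec_trans[of u "v (Suc i)" "v j"] by (cases "Suc i = j") auto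
qed

lemma supp_less_supp:
  assumes "u \<in> supp (x i)" "w \<in> supp (x j)" "i < j"
  shows "u \<prec> w"
proof -
  have "v j = w \<or> v j \<prec> w" using v_le[of j] assms by (auto simp: set_le_def)
  then show ?thesis using supp_less_v[OF assms(1,3)] prec_trans[of u "v j" w] by auto
qed

lemma supp_disjoint: "u \<in> supp (x i) \<Longrightarrow> u \<in> supp (x j) \<Longrightarrow> i = j"
  using supp_less_supp[of u i u j] supp_less_supp[of u j u i] prec_irrefl[of u]
  by (cases i j rule: linorder_cases) auto

definition comb :: "(nat \<Rightarrow> real) \<Rightarrow> nat set \<Rightarrow> nat list \<Rightarrow> real" where
  "comb a J = (\<lambda>s. \<Sum>i\<in>J. a i * x i s)"

lemma supp_comb: "supp (comb a J) \<subseteq> (\<Union>i\<in>J. supp (x i))"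
proof
  fix u assume "u \<in> supp (comb a J)"
  then have "(\<Sum>i\<in>J. a i * x i u) \<noteq> 0" by (simp add: comb_def supp_def)
  then obtain i where "i \<in> J" "a i * x i u \<noteq> 0" by (rule sum.not_neutral_contains_not_neutral)
  then show "u \<in> (\<Union>i\<in>J. supp (x i))" by (auto simp: supp_def)
qed

lemma comb_c00:
  assumes "finite J"
  shows "comb a J \<in> c00 k"
  unfolding c00_def
proof (intro CollectI conjI)
  show "finite (supp (comb a J))"
    using x_c00 assms by (intro finite_subset[OF supp_comb]) (auto simp: c00_def)
  show "supp (comb a J) \<subseteq> nd k" using supp_comb[of a J] x_c00 by (auto simp: c00_def)
qed

lemma comb_on_supp:
  assumes "finite J" "i \<in> J" "u \<in> supp (x i)"
  shows "comb a J u = a i * x i u"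
proof -
  have "x j u = 0" if "j \<noteq> i" for j using supp_disjoint[OF assms(3), of j] that by (auto simp: supp_def)
  then have "(\<Sum>j\<in>J. a j * x j u) = (\<Sum>j\<in>J. if j = i then a i * x i u else 0)"
    by (intro sum.cong) auto
  then show ?thesis using assms by (simp add: comb_def)
qed

lemma N_comb_upper:
  assumes p: "1 < p" and \<theta>: "\<theta> = real d powr (1 / p - 1)"
  shows "N (comb a {..<n}) \<le> 2 / \<theta> * (\<Sum>i<n. \<bar>a i\<bar> powr p) powr (1 / p)"
proof (rule N_leI)
  fix j
  define z where "z = comb a {..<n}"
  have z: "z \<in> c00 k" by (simp add: z_def comb_c00)
  show "level j (comb a {..<n}) \<le> 2 / \<theta> * (\<Sum>i<n. \<bar>a i\<bar> powr p) powr (1 / p)"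
  proof (cases "supp z = {}")
    case True
    then have "level j z \<le> 0" using level_le_l1[OF z, of j] by simp
    also have "0 \<le> 2 / \<theta> * (\<Sum>i<n. \<bar>a i\<bar> powr p) powr (1 / p)" using \<theta>_pos by simp
    finally show ?thesis by (simp add: z_def)
  next
    case False
    \<comment> \<open>This is \<open>1 / q\<close> for the conjugate exponent \<open>q\<close> of
      \<open>p\<close>; it fits both the decay \<open>\<theta> = d powr (- \<kappa>)\<close> and the
      Hoelder bound.\<close>
    define \<kappa> where "\<kappa> = 1 - 1 / p"
    have "0 < \<kappa>" "\<theta> = real d powr (- \<kappa>)" using p \<theta> by (simp_all add: \<kappa>_def)
    from level_norming_functional[OF this z False, of j]
    obtain B f \<mu> where B: "B \<subseteq> supp z" and norming: "norming \<kappa> B f \<mu>"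
      and le: "level j z \<le> (\<Sum>u\<in>B. f u * z u)" by blast
    have finB: "finite B" and \<mu>: "\<And>u. u \<in> B \<Longrightarrow> 0 \<le> \<mu> u" and sum_\<mu>: "sum \<mu> B = 1"
      using norming by (simp_all add: norming_def)
    define m where "m i = sum \<mu> (B \<inter> supp (x i))" for i
    have "(\<Sum>i<n. m i) = sum \<mu> (\<Union>i<n. B \<inter> supp (x i))"
      unfolding m_def using finB supp_disjoint by (intro sum.UNION_disjoint[symmetric]) auto
    also have "\<dots> \<le> sum \<mu> B" using finB \<mu> by (intro sum_mono2) auto
    finally have sum_m: "sum m {..<n} \<le> 1" by (simp add: sum_\<mu>)
    \<comment> \<open>Every leaf belongs to some block because \<open>B \<subseteq> supp z\<close>,
      and the blocks are successive; a leaf between two leaves of block \<open>i\<close> is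
      therefore in block \<open>i\<close>.\<close>
    have convex: "convex_part B (B \<inter> supp (x i))" for i
      unfolding convex_part_def
    proof (intro conjI ballI impI)
      fix u w s assume "u \<in> B \<inter> supp (x i)" "w \<in> B \<inter> supp (x i)" "s \<in> B" "u \<prec> s" "s \<prec> w"
      moreover from \<open>s \<in> B\<close> obtain j where j: "s \<in> supp (x j)"
        using B supp_comb[of a "{..<n}"] by (auto simp: z_def)
      have "i = j"
      proof (rule ccontr)
        assume "i \<noteq> j"
        then have "j < i \<or> i < j" by auto
        then have "s \<prec> u \<or> w \<prec> s"
          using supp_less_supp[OF j, of u i] supp_less_supp[OF _ j, of w i] calculation by blast
        then show False
          using calculation prec_trans[of s u s] prec_trans[of s w s] prec_irrefl[of s] by auto
      qed
      then show "s \<in> B \<inter> supp (x i)" using \<open>s \<in> B\<close> j by simp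
    qed simp
    have "(\<Sum>u\<in>B. f u * z u) = (\<Sum>u\<in>B. \<Sum>i<n. a i * (f u * x i u))"
      by (simp add: z_def comb_def sum_distrib_left mult.left_commute)
    also have "\<dots> = (\<Sum>i<n. a i * (\<Sum>u\<in>B. f u * x i u))"
      by (subst sum.swap) (simp add: sum_distrib_left)
    also have "\<dots> \<le> (\<Sum>i<n. 2 / \<theta> * (\<bar>a i\<bar> * m i powr \<kappa>))"
    proof (rule sum_mono)
      fix i
      have "(\<Sum>u\<in>B. f u * x i u) = (\<Sum>u\<in>B \<inter> supp (x i). f u * x i u)"
        using finB by (intro sum.mono_neutral_right) (auto simp: supp_def)
      then have "\<bar>\<Sum>u\<in>B. f u * x i u\<bar> \<le> 2 / \<theta> * m i powr \<kappa>"
        using norming_convex_le[OF norming x_c00 convex, of i] by (simp add: N_x m_def)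
      then have "\<bar>a i * (\<Sum>u\<in>B. f u * x i u)\<bar> \<le> \<bar>a i\<bar> * (2 / \<theta> * m i powr \<kappa>)"
        unfolding abs_mult by (rule mult_left_mono) simp
      then show "a i * (\<Sum>u\<in>B. f u * x i u) \<le> 2 / \<theta> * (\<bar>a i\<bar> * m i powr \<kappa>)"
        by (simp add: mult_ac)
    qed
    also have "\<dots> = 2 / \<theta> * (\<Sum>i<n. \<bar>a i\<bar> * m i powr \<kappa>)" by (simp only: sum_distrib_left)
    also have "\<dots> \<le> 2 / \<theta> * (\<Sum>i<n. \<bar>a i\<bar> powr p) powr (1 / p)"
    proof (rule mult_left_mono)
      show "(\<Sum>i<n. \<bar>a i\<bar> * m i powr \<kappa>) \<le> (\<Sum>i<n. \<bar>a i\<bar> powr p) powr (1 / p)"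
        unfolding \<kappa>_def using \<mu> by (intro weighted_Holder_bound p sum_m) (auto simp: m_def intro!: sum_nonneg)
    qed (use \<theta>_pos in simp)
    finally show ?thesis using le by (simp add: z_def)
  qed
qed

lemma N_comb_superadditive:
  fixes h :: "nat \<Rightarrow> nat"
  assumes J: "finite J" and h: "h ` J \<subseteq> {..<d}" "mono_on J h"
  shows "\<theta> * (\<Sum>s<d. N (comb a {i \<in> J. h i = s})) \<le> N (comb a J)"
proof -
  define G where "G s = {i \<in> J. h i = s}" for s
  \<comment> \<open>Empty groups have no \<open>Min\<close> and \<open>Max\<close> to define
    \<open>E s\<close> with; they contribute norm \<open>0\<close>.\<close>
  define R where "R = {s \<in> {..<d}. G s \<noteq> {}}"
  \<comment> \<open>By nesting, the blocks of group \<open>s\<close> all lie in the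
    \<open>X_max\<close> set of the first one. The cut is made at the \<open>v\<close> following the
    last one; as \<open>h\<close> is monotone, this is at most the \<open>v\<close> where a later
    group starts, so the sets \<open>E s\<close> are successive.\<close>
  define E where "E s = {y \<in> X_max k (v (Min (G s))). y \<prec> v (Suc (Max (G s)))}" for s
  have finG: "finite (G s)" for s using J by (simp add: G_def)
  have bounds: "Min (G s) \<le> i" "i \<le> Max (G s)" if "i \<in> G s" for i s
    using that finG by auto
  have supp_E: "supp (x i) \<subseteq> E s" if i: "i \<in> G s" for i s
  proof
    fix u assume u: "u \<in> supp (x i)"
    have "u \<in> X_max k (v i)" using u supp_X_max by blast
    then have "u \<in> X_max k (v (Min (G s)))"
      using X_max_mono[OF v_nd k v_in_X_max[OF bounds(1)[OF i]]] by blast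
    moreover have "u \<prec> v (Suc (Max (G s)))" using supp_less_v[OF u] bounds(2)[OF i] by simp
    ultimately show "u \<in> E s" by (simp add: E_def)
  qed
  have "(\<Sum>s<d. N (comb a (G s))) = (\<Sum>s\<in>R. N (comb a (G s)))"
  proof (rule sum.mono_neutral_right)
    have "comb a {} \<in> c00 k" by (simp add: comb_c00)
    moreover have "supp (comb a {}) = {}" by (simp add: comb_def supp_def)
    ultimately have "N (comb a {}) \<le> 0"
      using level_le_l1[of "comb a {}"] by (intro N_leI) simp
    then have "N (comb a {}) = 0" using N_nonneg[OF \<open>comb a {} \<in> c00 k\<close>] by simp
    then show "\<forall>s\<in>{..<d} - R. N (comb a (G s)) = 0" by (auto simp: R_def)
  qed (auto simp: R_def)
  also have "\<dots> \<le> (\<Sum>s\<in>R. N (restr (E s) (comb a J)))"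
  proof (intro sum_mono N_mono comb_c00 restr_c00 finG J)
    fix s u
    show "\<bar>comb a (G s) u\<bar> \<le> \<bar>restr (E s) (comb a J) u\<bar>"
    proof (cases "u \<in> supp (comb a (G s))")
      case True
      then obtain i where i: "i \<in> G s" "u \<in> supp (x i)" using supp_comb by blast
      then have "u \<in> E s" using supp_E by blast
      moreover have "i \<in> J" using i by (simp add: G_def)
      ultimately show ?thesis
        using comb_on_supp[OF finG i] comb_on_supp[OF J _ i(2)] by (simp add: restr_def)
    qed (simp add: supp_def)
  qed
  finally have "\<theta> * (\<Sum>s<d. N (comb a (G s))) \<le> \<theta> * (\<Sum>s\<in>R. N (restr (E s) (comb a J)))"
    using \<theta>_pos by simp
  also have "\<dots> \<le> N (comb a J)"
  proof (rule indexed_admissible_le_N[OF comb_c00[OF J]])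
    show "finite R" by (simp add: R_def)
    have "card R \<le> card {..<d}" by (intro card_mono) (auto simp: R_def)
    then show "card R \<le> d" by simp
    show "E s \<in> AR k" if s: "s \<in> R" for s
    proof -
      obtain i where i: "i \<in> G s" using s by (auto simp: R_def)
      have "Min (G s) < Suc (Max (G s))" using bounds[OF i] by simp
      then show ?thesis
        unfolding E_def using v_nd v_in_X_max v_less by (intro X_max_below_in_AR) auto
    qed
    show "set_less (E s) (E t)" if st: "s \<in> R" "t \<in> R" "s < t" for s t
      unfolding set_less_def
    proof (intro ballI)
      fix y w assume y: "y \<in> E s" and w: "w \<in> E t"
      have "Max (G s) \<in> G s" "Min (G t) \<in> G t" using st finG by (auto simp: R_def)
      then have m: "Max (G s) \<in> J" "h (Max (G s)) = s" "Min (G t) \<in> J" "h (Min (G t)) = t"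
        by (auto simp: G_def)
      have "Max (G s) < Min (G t)"
      proof (rule ccontr)
        assume "\<not> Max (G s) < Min (G t)"
        then show False using mono_onD[OF h(2) m(3,1)] m st by simp
      qed
      then have "v (Suc (Max (G s))) = v (Min (G t)) \<or> v (Suc (Max (G s))) \<prec> v (Min (G t))"
        using v_less[of "Suc (Max (G s))" "Min (G t)"] by (cases "Suc (Max (G s)) = Min (G t)") auto
      moreover have "v (Min (G t)) = w \<or> v (Min (G t)) \<prec> w"
        using w X_max_ge[OF v_nd k] by (simp add: E_def)
      moreover have "y \<prec> v (Suc (Max (G s)))" using y by (simp add: E_def)
      ultimately show "y \<prec> w" using prec_trans by metis
    qed
  qed
  finally show ?thesis by (simp add: G_def)
qed

lemma N_comb_lower:
  assumes p: "1 < p" and d: "2 \<le> d" and \<theta>: "\<theta> = real d powr (1 / p - 1)"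
  shows "\<theta>\<^sup>2 * (\<Sum>i<n. \<bar>a i\<bar> powr p) powr (1 / p) \<le> N (comb a {..<n})"
proof -
  \<comment> \<open>Zero coefficients are removed because an index with share \<open>0\<close> has
    no depth in the \<open>d\<close>-adic tree.\<close>
  define J where "J = {i \<in> {..<n}. a i \<noteq> 0}"
  have finJ: "finite J" by (simp add: J_def)
  have "comb a {..<n} = comb a J"
    unfolding comb_def by (rule ext, rule sum.mono_neutral_right) (auto simp: J_def)
  moreover have "(\<Sum>i<n. \<bar>a i\<bar> powr p) = (\<Sum>i\<in>J. \<bar>a i\<bar> powr p)"
    by (rule sum.mono_neutral_right) (auto simp: J_def)
  moreover have "\<theta>\<^sup>2 * (\<Sum>i\<in>J. \<bar>a i\<bar> powr p) powr (1 / p) \<le> N (comb a J)"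
  proof (rule superadditive_lower_lp[OF finJ d p \<theta>])
    show "0 < \<bar>a i\<bar>" if "i \<in> J" for i using that by (simp add: J_def)
    show "\<bar>a i\<bar> \<le> N (comb a {i})" for i
      using N_scale_ge[OF x_c00, of "a i" i] by (simp add: N_x comb_def)
    show "0 \<le> N (comb a {})" by (simp add: N_nonneg comb_c00)
    show "\<theta> * (\<Sum>s<d. N (comb a {i \<in> J'. h i = s})) \<le> N (comb a J')"
      if "J' \<subseteq> J" "h ` J' \<subseteq> {..<d}" "mono_on J' h" for J' h
      using that finJ by (intro N_comb_superadditive) (auto intro: finite_subset)
  qed
  ultimately show ?thesis by simp
qed

end

lemma lp_norm_basis_comb:
  "lp_norm p (\<lambda>t. \<Sum>i<n. a i * lp_basis i t) = (\<Sum>i<n. \<bar>a i\<bar> powr p) powr (1 / p)"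
proof -
  have eq: "(\<Sum>i<n. a i * lp_basis i t) = (if t < n then a t else 0)" for t
    by (simp add: lp_basis_def if_distrib[of "\<lambda>c. _ * c"] cong: if_cong)
  have "(\<Sum>t. \<bar>\<Sum>i<n. a i * lp_basis i t\<bar> powr p) = (\<Sum>t<n. \<bar>\<Sum>i<n. a i * lp_basis i t\<bar> powr p)"
    by (rule suminf_finite) (auto simp: eq)
  then show ?thesis by (simp add: lp_norm_def eq)
qed

theorem theorem5p1:
  fixes k d :: nat and \<theta> p :: real
    and x :: "nat \<Rightarrow> nat list \<Rightarrow> real" and v :: "nat \<Rightarrow> nat list"
  assumes "k \<ge> 2" and "d \<ge> 1"
    and "0 < \<theta>" and "\<theta> < 1" and "real d * \<theta> > 1"
    and "1 < p" and "real d * \<theta> = real d powr (1 / p)"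
    and "normalized_block_sequence k d \<theta> x"
    and "\<And>i. v i \<in> nd k"
    and "\<And>i. set_le {v i} (supp (x i))"
    and "\<And>i. set_less (supp (x i)) {v (Suc i)}"
    and "\<And>i. supp (x i) \<subseteq> X_max k (v i)"
    and "\<And>i. v (Suc i) \<in> X_max k (v i)"
  shows "equivalent_sequences (T_norm k d \<theta>) x (lp_norm p) lp_basis"
proof -
  interpret X_max_blocks k d \<theta> x v
    using assms by unfold_locales
      (simp_all add: normalized_block_sequence_def block_sequence_def)
  \<comment> \<open>For \<open>d = 1\<close> the assumptions \<open>d * \<theta> > 1\<close> and
    \<open>\<theta> < 1\<close> clash; \<open>d \<ge> 2\<close> is what makes the
    \<open>d\<close>-adic tree branch.\<close>
  have "d \<noteq> 1" using assms(4,5) by auto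
  then have d: "2 \<le> d" using assms(2) by simp
  have \<theta>: "\<theta> = real d powr (1 / p - 1)"
    using assms(7) d by (simp add: powr_diff field_simps)
  show ?thesis
    unfolding equivalent_sequences_def lp_norm_basis_comb
  proof (intro exI conjI allI)
    fix n and a :: "nat \<Rightarrow> real"
    show "\<theta>\<^sup>2 * (\<Sum>i<n. \<bar>a i\<bar> powr p) powr (1 / p) \<le> T_norm k d \<theta> (\<lambda>s. \<Sum>i<n. a i * x i s)"
      using N_comb_lower[OF assms(6) d \<theta>] by (simp add: comb_def)
    show "T_norm k d \<theta> (\<lambda>s. \<Sum>i<n. a i * x i s) \<le> 2 / \<theta> * (\<Sum>i<n. \<bar>a i\<bar> powr p) powr (1 / p)"
      using N_comb_upper[OF assms(6) \<theta>] by (simp add: comb_def)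
  qed (use assms(3) in simp_all)
qed

end
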